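(* Let $\omega>0$ be such that $\omega^2$ is generic irrational, let $\Lambda>0$, $\tau>1$, and let $s\ge 0$. Let $v_0=\{v_k\}_{k\in\mathbb{Z}^2}\in h^s$. For either choice of sign $\pm$, there exists a unique global-in-time solution $z\in C^1([0,\infty);h^{s-2})\cap C([0,\infty);h^s)$ to the Cauchy problem $$\begin{cases}\dot z_k=i\lambda_k z_k\pm i\displaystyle\sum_{k=k_1+k_2-k_3}^{**}z_{k_1}z_{k_2}\bar z_{k_3}, & k\in\mathbb{Z}^2,\\ z(0)=v_0,\end{cases}$$ where $\sum^{**}$ means that the sum is taken over those $(k_1,k_2,k_3)$ for which $(k_1,k_2,k_3,k)$ is a $(\Lambda,\tau)$-quasi-resonant quartet.
   Context: For $k=(m,\ell)\in\mathbb{Z}^2$, $\lambda_k=m^2+\omega^2\ell^2$. For $r\in\mathbb{R}$, $h^r=h^r(\mathbb{Z}^2)$ is the space of complex sequences $x=\{x_n\}_{n\in\mathbb{Z}^2}$ with $\|x\|_{h^r}=\big(\sum_n|x_n|^2\langle n\rangle^{2r}\big)^{1/2}<\infty$, $\langle n\rangle=\sqrt{|n|^2+1}$. $\omega^2$ generic irrational: $\omega^2$ is irrational and for every $C>0$ and every $\sigma>0$ there are only finitely many $(p,q)\in\mathbb{Z}\times\mathbb{Z}_+$ with $|p/q-\omega^2|\le C/q^{2+\sigma}$. $(\Lambda,\tau)$-quasi-resonant quartet: $(k_1,k_2,k_3,k_4)\in(\mathbb{Z}^2)^4$ with $k_1+k_2-k_3-k_4=0$ and $$|\lambda_{k_1}+\lambda_{k_2}-\lambda_{k_3}-\lambda_{k_4}|\le\frac{\Lambda}{(|k_1|^2+|k_2|^2+|k_3|^2+|k_4|^2)^{1+\tau}},$$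 where the quartet with all $k_i=0$ is counted as quasi-resonant. *)

theory Defs
  imports "HOL-Analysis.Analysis"
begin

type_synonym lattice = "int \<times> int"

definition sqnorm :: "lattice \<Rightarrow> real" where
  "sqnorm k = (of_int (fst k))\<^sup>2 + (of_int (snd k))\<^sup>2"

definition bracket :: "lattice \<Rightarrow> real" where
  "bracket k = sqrt (sqnorm k + 1)"

definition eigenval :: "real \<Rightarrow> lattice \<Rightarrow> real" where
  "eigenval \<omega> k = (of_int (fst k))\<^sup>2 + \<omega>\<^sup>2 * (of_int (snd k))\<^sup>2"

definition hspace :: "real \<Rightarrow> (lattice \<Rightarrow> complex) set" where
  "hspace r = {x. (\<lambda>n. (cmod (x n))\<^sup>2 * bracket n powr (2 * r)) summable_on UNIV}"

text \<open>Meaningful only on \<^term>\<open>hspace r\<close>: outside it, the sum takes the default value \<open>0\<close>.\<close>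

definition hnorm :: "real \<Rightarrow> (lattice \<Rightarrow> complex) \<Rightarrow> real" where
  "hnorm r x = sqrt (\<Sum>\<^sub>\<infinity>n. (cmod (x n))\<^sup>2 * bracket n powr (2 * r))"

definition generic_irrational :: "real \<Rightarrow> bool" where
  "generic_irrational x \<longleftrightarrow> x \<notin> \<rat> \<and>
     (\<forall>C>0. \<forall>\<sigma>>0. finite {(p :: int, q :: int). 0 < q \<and>
        \<bar>of_int p / of_int q - x\<bar> \<le> C / of_int q powr (2 + \<sigma>)})"

definition quasi_resonant ::
  "real \<Rightarrow> real \<Rightarrow> real \<Rightarrow> lattice \<Rightarrow> lattice \<Rightarrow> lattice \<Rightarrow> lattice \<Rightarrow> bool" where
  "quasi_resonant \<omega> \<Lambda> \<tau> k1 k2 k3 k4 \<longleftrightarrow>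
     k1 = 0 \<and> k2 = 0 \<and> k3 = 0 \<and> k4 = 0 \<or>
     k1 + k2 - k3 - k4 = 0 \<and>
     \<bar>eigenval \<omega> k1 + eigenval \<omega> k2 - eigenval \<omega> k3 - eigenval \<omega> k4\<bar>
       \<le> \<Lambda> / (sqnorm k1 + sqnorm k2 + sqnorm k3 + sqnorm k4) powr (1 + \<tau>)"

definition qr_triples :: "real \<Rightarrow> real \<Rightarrow> real \<Rightarrow> lattice \<Rightarrow> (lattice \<times> lattice \<times> lattice) set" where
  "qr_triples \<omega> \<Lambda> \<tau> k = {(k1, k2, k3). quasi_resonant \<omega> \<Lambda> \<tau> k1 k2 k3 k}"

definition cubic_term :: "(lattice \<Rightarrow> complex) \<Rightarrow> lattice \<times> lattice \<times> lattice \<Rightarrow> complex" where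
  "cubic_term z = (\<lambda>(k1, k2, k3). z k1 * z k2 * cnj (z k3))"

text \<open>The class $C([0,\infty); h^r)$.\<close>

definition h_continuous :: "real \<Rightarrow> (real \<Rightarrow> lattice \<Rightarrow> complex) \<Rightarrow> bool" where
  "h_continuous r u \<longleftrightarrow> (\<forall>t\<ge>0. u t \<in> hspace r) \<and>
     (\<forall>t\<ge>0. ((\<lambda>t'. hnorm r (\<lambda>k. u t' k - u t k)) \<longlongrightarrow> 0) (at t within {0..}))"

text \<open>\<open>h_C1 r u u'\<close>: \<open>u\<close> belongs to $C^1([0,\infty); h^r)$ with derivative \<open>u'\<close>,
  difference quotients being taken in the norm of $h^r$ (one-sided at time \<open>0\<close>).\<close>

definition h_C1 ::
  "real \<Rightarrow> (real \<Rightarrow> lattice \<Rightarrow> complex) \<Rightarrow> (real \<Rightarrow> lattice \<Rightarrow> complex) \<Rightarrow> bool" where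
  "h_C1 r u u' \<longleftrightarrow> h_continuous r u \<and> h_continuous r u' \<and>
     (\<forall>t\<ge>0. ((\<lambda>t'. hnorm r (\<lambda>k. (u t' k - u t k) / of_real (t' - t) - u' t k)) \<longlongrightarrow> 0)
        (at t within {0..}))"

text \<open>The argument \<open>\<epsilon>\<close> is the sign in front of the nonlinearity.  The sum over triples is in
  general infinite, so its (unconditional) convergence is part of the notion of solution.
  Only the values at times \<open>t \<ge> 0\<close> matter.\<close>

definition is_solution ::
  "real \<Rightarrow> real \<Rightarrow> real \<Rightarrow> real \<Rightarrow> real \<Rightarrow> (lattice \<Rightarrow> complex) \<Rightarrow> (real \<Rightarrow> lattice \<Rightarrow> complex) \<Rightarrow> bool"
where
  "is_solution \<omega> \<Lambda> \<tau> s \<epsilon> v0 z \<longleftrightarrow>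
     h_continuous s z \<and> z 0 = v0 \<and>
     (\<exists>z'. h_C1 (s - 2) z z' \<and>
        (\<forall>t\<ge>0. \<forall>k. cubic_term (z t) summable_on qr_triples \<omega> \<Lambda> \<tau> k \<and>
           z' t k = \<i> * of_real (eigenval \<omega> k) * z t k
             + of_real \<epsilon> * \<i> * (\<Sum>\<^sub>\<infinity>p\<in>qr_triples \<omega> \<Lambda> \<tau> k. cubic_term (z t) p)))"

end

theory Submission
  imports Defs
begin

text \<open>
  On the hyperplane \<open>k1 + k2 = k3 + k4\<close> the frequency defect is \<open>2 * (p + \<omega>\<^sup>2 * q)\<close>, where
  \<open>p\<close> and \<open>q\<close> are the products of the coordinate differences of \<open>k1\<close> to \<open>k3\<close> and \<open>k4\<close>.  As
  \<open>\<omega>\<^sup>2\<close> has irrationality exponent 2, quasi-resonance with \<open>(p, q) \<noteq> 0\<close> keeps \<open>p + \<omega>\<^sup>2 * q\<close>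
  away from zero and so bounds the size of the quartet.  Thus all but finitely many quasi-resonant
  quartets have \<open>p = q = 0\<close>: they are (possibly degenerate) rectangles with sides parallel to the
  axes.  In each of the four families of such rectangles both \<open>(k1, k2)\<close> and \<open>(k3, k4)\<close> determine
  the quartet, and Cauchy-Schwarz bounds the quadrilinear form on the square-summable sequences.

  After the substitution \<open>z t k = cis (t * eigenval \<omega> k) * y t k\<close> the vector field is cubic and
  bounded, and the symmetry \<open>(k1, k2, k3, k4) \<mapsto> (k3, k4, k1, k2)\<close> of the quartets makes it orthogonal
  to \<open>y\<close>.  Composed with a radial cutoff it becomes globally Lipschitz, and conservation of the norm
  shows that the cutoff is never active; this gives a unique global solution without weights.
  In a rectangle the weight of \<open>k4\<close> is controlled by that of the larger of \<open>k1\<close> and \<open>k2\<close>, which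
  makes the weighted equation linear and bounded along the solution already found.
\<close>

section \<open>The Hilbert space of square-summable families\<close>

text \<open>A type of its own, so that integrals and derivatives of functions with values in a
  Banach space apply. The scalars are real: the conjugate in the nonlinearity leaves it trilinear
  over the reals only.\<close>

typedef 'a ell2 = "{x :: 'a \<Rightarrow> complex. (\<lambda>i. (cmod (x i))\<^sup>2) summable_on UNIV}"
  morphisms coord Abs_ell2
  by (rule exI[of _ "\<lambda>_. 0"]) auto

setup_lifting type_definition_ell2

lemma ell2_eqI: "(\<And>i. coord x i = coord y i) \<Longrightarrow> x = y"
  by transfer auto

lemma summable_coord: "(\<lambda>i. (cmod (coord x i))\<^sup>2) summable_on UNIV"
  by transfer auto

lemma summable_nonnegI:
  fixes f :: "'a \<Rightarrow> real"
  assumes "\<And>i. i \<in> A \<Longrightarrow> 0 \<le> f i" "\<And>F. finite F \<Longrightarrow> F \<subseteq> A \<Longrightarrow> sum f F \<le> B"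
  shows "f summable_on A"
  by (rule nonneg_bdd_above_summable_on) (use assms in \<open>auto simp: bdd_above_def\<close>)

lemma summable_sq_add:
  fixes x y :: "'a \<Rightarrow> complex"
  assumes "(\<lambda>i. (cmod (x i))\<^sup>2) summable_on UNIV" "(\<lambda>i. (cmod (y i))\<^sup>2) summable_on UNIV"
  shows "(\<lambda>i. (cmod (x i + y i))\<^sup>2) summable_on UNIV"
proof (rule summable_on_comparison_test)
  show "(\<lambda>i. 2 * (cmod (x i))\<^sup>2 + 2 * (cmod (y i))\<^sup>2) summable_on UNIV"
    by (intro summable_on_add summable_on_cmult_right assms)
  show "(cmod (x i + y i))\<^sup>2 \<le> 2 * (cmod (x i))\<^sup>2 + 2 * (cmod (y i))\<^sup>2" for i
  proof -
    have "(cmod (x i + y i))\<^sup>2 \<le> (cmod (x i) + cmod (y i))\<^sup>2"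
      by (intro power_mono norm_triangle_ineq) auto
    also have "\<dots> \<le> 2 * (cmod (x i))\<^sup>2 + 2 * (cmod (y i))\<^sup>2"
      using sum_squares_bound[of "cmod (x i)" "cmod (y i)"] by (simp add: power2_sum)
    finally show ?thesis .
  qed
qed auto

lemma summable_sq_mult:
  fixes x m :: "'a \<Rightarrow> complex"
  assumes "(\<lambda>i. (cmod (x i))\<^sup>2) summable_on UNIV" "\<And>i. cmod (m i) \<le> B"
  shows "(\<lambda>i. (cmod (m i * x i))\<^sup>2) summable_on UNIV"
proof (rule summable_on_comparison_test)
  show "(\<lambda>i. B\<^sup>2 * (cmod (x i))\<^sup>2) summable_on UNIV"
    by (intro summable_on_cmult_right assms)
  show "(cmod (m i * x i))\<^sup>2 \<le> B\<^sup>2 * (cmod (x i))\<^sup>2" for i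
    unfolding norm_mult power_mult_distrib
    by (intro mult_right_mono power_mono assms(2)) auto
qed auto

lemma summable_inner:
  fixes x y :: "'a \<Rightarrow> complex"
  assumes "(\<lambda>i. (cmod (x i))\<^sup>2) summable_on UNIV" "(\<lambda>i. (cmod (y i))\<^sup>2) summable_on UNIV"
  shows "(\<lambda>i. x i \<bullet> y i) summable_on UNIV"
proof (rule abs_summable_summable, rule summable_on_comparison_test)
  show "(\<lambda>i. (cmod (x i))\<^sup>2 + (cmod (y i))\<^sup>2) summable_on UNIV"
    by (intro summable_on_add assms)
  show "norm (x i \<bullet> y i) \<le> (cmod (x i))\<^sup>2 + (cmod (y i))\<^sup>2" for i
    using Cauchy_Schwarz_ineq2[of "x i" "y i"] sum_squares_bound[of "cmod (x i)" "cmod (y i)"]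
      zero_le_power2[of "cmod (x i)"] zero_le_power2[of "cmod (y i)"]
    by (auto simp: real_norm_def)
qed auto

section \<open>The real Hilbert space structure, given by the real part of the Hermitian
  product\<close>

instantiation ell2 :: (type) real_inner
begin

lift_definition zero_ell2 :: "'a ell2" is "\<lambda>_. 0" by auto
lift_definition plus_ell2 :: "'a ell2 \<Rightarrow> 'a ell2 \<Rightarrow> 'a ell2" is "\<lambda>x y i. x i + y i"
  by (auto intro: summable_sq_add)
lift_definition uminus_ell2 :: "'a ell2 \<Rightarrow> 'a ell2" is "\<lambda>x i. - x i" by auto
lift_definition minus_ell2 :: "'a ell2 \<Rightarrow> 'a ell2 \<Rightarrow> 'a ell2" is "\<lambda>x y i. x i - y i"
  using summable_sq_add[of _ "\<lambda>i. - y i" for y] by auto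
lift_definition scaleR_ell2 :: "real \<Rightarrow> 'a ell2 \<Rightarrow> 'a ell2" is "\<lambda>r x i. of_real r * x i"
  by (auto intro!: summable_sq_mult)
lift_definition inner_ell2 :: "'a ell2 \<Rightarrow> 'a ell2 \<Rightarrow> real" is "\<lambda>x y. \<Sum>\<^sub>\<infinity>i. x i \<bullet> y i" .

definition norm_ell2 :: "'a ell2 \<Rightarrow> real" where "norm_ell2 x = sqrt (inner x x)"
definition dist_ell2 :: "'a ell2 \<Rightarrow> 'a ell2 \<Rightarrow> real" where "dist_ell2 x y = norm (x - y)"
definition sgn_ell2 :: "'a ell2 \<Rightarrow> 'a ell2" where "sgn_ell2 x = inverse (norm x) *\<^sub>R x"
definition uniformity_ell2 :: "('a ell2 \<times> 'a ell2) filter" where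
  "uniformity_ell2 = (INF e\<in>{0 <..}. principal {(x, y). dist x y < e})"
definition open_ell2 :: "'a ell2 set \<Rightarrow> bool" where
  "open_ell2 S = (\<forall>x\<in>S. \<forall>\<^sub>F (x', y) in uniformity. x' = x \<longrightarrow> y \<in> S)"

instance
proof
  fix x y z :: "'a ell2" and r q :: real
  show "x + y + z = x + (y + z)" by transfer (simp add: add.assoc)
  show "x + y = y + x" by transfer (simp add: add.commute)
  show "0 + x = x" by transfer simp
  show "- x + x = 0" by transfer simp
  show "x - y = x + - y" by transfer simp
  show "r *\<^sub>R (x + y) = r *\<^sub>R x + r *\<^sub>R y" by transfer (simp add: distrib_left)
  show "(r + q) *\<^sub>R x = r *\<^sub>R x + q *\<^sub>R x" by transfer (simp add: distrib_right)
  show "r *\<^sub>R q *\<^sub>R x = (r * q) *\<^sub>R x" by transfer (simp add: mult.assoc)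
  show "1 *\<^sub>R x = x" by transfer simp
  show "x \<bullet> y = y \<bullet> x" by transfer (simp add: inner_commute)
  show "(x + y) \<bullet> z = x \<bullet> z + y \<bullet> z"
    by transfer (auto simp: inner_add_left intro!: infsum_add summable_inner)
  show "(r *\<^sub>R x) \<bullet> y = r * (x \<bullet> y)"
    by transfer (auto simp flip: scaleR_conv_of_real intro!: infsum_cmult_right summable_inner)
  show "0 \<le> x \<bullet> x"
    by transfer (auto intro: infsum_nonneg)
  show "x \<bullet> x = 0 \<longleftrightarrow> x = 0"
  proof
    assume "x \<bullet> x = 0"
    then show "x = 0"
    proof (transfer, intro ext)
      fix x :: "'a \<Rightarrow> complex" and i
      assume *: "(\<lambda>i. (cmod (x i))\<^sup>2) summable_on UNIV" "(\<Sum>\<^sub>\<infinity>i. x i \<bullet> x i) = 0"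
      have "x i \<bullet> x i = 0"
        by (rule nonneg_infsum_le_0D[where A=UNIV and f="\<lambda>i. x i \<bullet> x i"])
           (use * in \<open>auto intro: summable_inner\<close>)
      then show "x i = 0" by simp
    qed
  qed (transfer, simp)
qed (simp_all only: norm_ell2_def dist_ell2_def sgn_ell2_def uniformity_ell2_def open_ell2_def)

end

lemma coord_simps [simp]:
  "coord 0 i = 0" "coord (x + y) i = coord x i + coord y i" "coord (- x) i = - coord x i"
  "coord (x - y) i = coord x i - coord y i" "coord (r *\<^sub>R x) i = of_real r * coord x i"
  by (transfer, simp)+

lemma inner_ell2_eq: "x \<bullet> y = (\<Sum>\<^sub>\<infinity>i. coord x i \<bullet> coord y i)"
  by transfer simp

lemma norm_ell2_eq: "norm x = sqrt (\<Sum>\<^sub>\<infinity>i. (cmod (coord x i))\<^sup>2)"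
  unfolding norm_eq_sqrt_inner inner_ell2_eq by (simp add: dot_square_norm)

lemma norm_ell2_sq: "(norm x)\<^sup>2 = (\<Sum>\<^sub>\<infinity>i. (cmod (coord x i))\<^sup>2)"
  by (simp add: norm_ell2_eq infsum_nonneg)

lemma sum_coord_le: "finite F \<Longrightarrow> (\<Sum>i\<in>F. (cmod (coord x i))\<^sup>2) \<le> (norm x)\<^sup>2"
  unfolding norm_ell2_sq by (rule finite_sum_le_infsum) (auto intro: summable_coord)

lemma coord_le_norm: "cmod (coord x i) \<le> norm x"
  using sum_coord_le[of "{i}" x] by (simp add: power2_le_iff_abs_le)

text \<open>Reduces a norm bound to finite partial sums, the form in which the estimates below are
  proved.\<close>

lemma norm_ell2_leI:
  assumes "0 \<le> B" "\<And>F. finite F \<Longrightarrow> (\<Sum>i\<in>F. (cmod (coord x i))\<^sup>2) \<le> B\<^sup>2"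
  shows "norm x \<le> B"
proof (rule power2_le_imp_le)
  show "(norm x)\<^sup>2 \<le> B\<^sup>2"
    unfolding norm_ell2_sq by (rule infsum_le_finite_sums) (auto intro: summable_coord assms)
qed fact

lemma coord_Abs_ell2:
  assumes "\<And>F. finite F \<Longrightarrow> (\<Sum>i\<in>F. (cmod (f i))\<^sup>2) \<le> B"
  shows "coord (Abs_ell2 f) = f"
  by (rule Abs_ell2_inverse) (use assms in \<open>auto intro!: summable_nonnegI\<close>)

lemma bounded_linear_coord: "bounded_linear (\<lambda>x. coord x i)"
  by (rule bounded_linear_intro[where K=1])
     (auto simp: scaleR_conv_of_real intro: coord_le_norm)

text \<open>The coordinatewise limit \<open>f\<close> is also the limit in norm: the Cauchy bound on
  a finite sum of coordinates survives the passage to the limit in one index, with a constant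
  independent of the finite set.\<close>

instance ell2 :: (type) banach
proof
  fix X :: "nat \<Rightarrow> 'a ell2"
  assume "Cauchy X"
  have "Cauchy (\<lambda>n. coord (X n) i)" for i
    using bounded_linear.Cauchy[OF bounded_linear_coord \<open>Cauchy X\<close>] .
  then obtain f where f: "\<And>i. (\<lambda>n. coord (X n) i) \<longlonglongrightarrow> f i"
    unfolding Cauchy_convergent_iff convergent_def by metis
  have close: "(\<Sum>i\<in>F. (cmod (coord (X n) i - f i))\<^sup>2) \<le> e\<^sup>2"
    if "0 < e" "finite F" "\<And>m n. N \<le> m \<Longrightarrow> N \<le> n \<Longrightarrow> norm (X m - X n) < e" "N \<le> n" for e N n F
  proof (rule tendsto_upperbound)
    show "(\<lambda>m. \<Sum>i\<in>F. (cmod (coord (X n) i - coord (X m) i))\<^sup>2) \<longlonglongrightarrow> (\<Sum>i\<in>F. (cmod (coord (X n) i - f i))\<^sup>2)"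
      by (intro tendsto_intros f)
    show "\<forall>\<^sub>F m in sequentially. (\<Sum>i\<in>F. (cmod (coord (X n) i - coord (X m) i))\<^sup>2) \<le> e\<^sup>2"
      using eventually_ge_at_top[of N]
    proof eventually_elim
      case (elim m)
      have "(\<Sum>i\<in>F. (cmod (coord (X n) i - coord (X m) i))\<^sup>2) \<le> (norm (X n - X m))\<^sup>2"
        using sum_coord_le[OF \<open>finite F\<close>, of "X n - X m"] by simp
      also have "\<dots> \<le> e\<^sup>2"
        using that(3)[of n m] elim \<open>N \<le> n\<close> by (intro power_mono) auto
      finally show ?case .
    qed
  qed simp
  have C: "\<exists>N. \<forall>m\<ge>N. \<forall>n\<ge>N. norm (X m - X n) < e" if "0 < e" for e
    using \<open>Cauchy X\<close> that unfolding Cauchy_iff by blast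
  obtain N where N: "\<And>m n. N \<le> m \<Longrightarrow> N \<le> n \<Longrightarrow> norm (X m - X n) < 1"
    using C[of 1] by auto
  have "(\<lambda>i. (cmod (coord (X N) i - f i))\<^sup>2) summable_on UNIV"
    by (rule summable_nonnegI) (use close[OF _ _ N] in auto)
  \<comment> \<open>\<open>f\<close> is \<open>X N\<close> minus the square-summable sequence
    \<open>X N - f\<close>.\<close>
  then have "(\<lambda>i. (cmod (coord (X N) i + - (coord (X N) i - f i)))\<^sup>2) summable_on UNIV"
    by (intro summable_sq_add summable_coord) (simp add: norm_minus_commute)
  then have coordf: "coord (Abs_ell2 f) = f"
    by (intro Abs_ell2_inverse) simp
  have "X \<longlonglongrightarrow> Abs_ell2 f"
  proof (rule LIMSEQ_I)
    fix e :: real assume "0 < e"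
    then obtain N where N: "\<And>m n. N \<le> m \<Longrightarrow> N \<le> n \<Longrightarrow> norm (X m - X n) < e / 2"
      using C[of "e / 2"] by auto
    have "norm (X n - Abs_ell2 f) \<le> e / 2" if "n \<ge> N" for n
      by (rule norm_ell2_leI) (use close[OF _ _ N that] \<open>0 < e\<close> in \<open>auto simp: coordf\<close>)
    then show "\<exists>N. \<forall>n\<ge>N. norm (X n - Abs_ell2 f) < e"
      using \<open>0 < e\<close> by (intro exI[of _ N]) force
  qed
  then show "convergent X" unfolding convergent_def by blast
qed

section \<open>Diagonal operators with bounded symbol\<close>

definition diag :: "('a \<Rightarrow> complex) \<Rightarrow> 'a ell2 \<Rightarrow> 'a ell2" where
  "diag m x = Abs_ell2 (\<lambda>i. m i * coord x i)"

lemma coord_diag: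
  assumes "\<And>i. cmod (m i) \<le> B"
  shows "coord (diag m x) i = m i * coord x i"
  unfolding diag_def
  by (subst Abs_ell2_inverse) (auto intro: summable_sq_mult summable_coord assms)

lemma norm_diag_le:
  assumes m: "\<And>i. cmod (m i) \<le> B"
  shows "norm (diag m x) \<le> B * norm x"
proof (rule norm_ell2_leI)
  have "0 \<le> B" using m[of undefined] norm_ge_zero order_trans by blast
  then show "0 \<le> B * norm x" by simp
  fix F :: "'a set" assume F: "finite F"
  have "(\<Sum>i\<in>F. (cmod (coord (diag m x) i))\<^sup>2) \<le> (\<Sum>i\<in>F. B\<^sup>2 * (cmod (coord x i))\<^sup>2)"
    unfolding coord_diag[OF m] norm_mult power_mult_distrib
    by (intro sum_mono mult_right_mono power_mono m) auto
  also have "\<dots> \<le> (B * norm x)\<^sup>2"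
    unfolding sum_distrib_left[symmetric] power_mult_distrib
    by (intro mult_left_mono sum_coord_le F) auto
  finally show "(\<Sum>i\<in>F. (cmod (coord (diag m x) i))\<^sup>2) \<le> (B * norm x)\<^sup>2" .
qed

lemma bounded_linear_diag:
  assumes m: "\<And>i. cmod (m i) \<le> B"
  shows "bounded_linear (diag m)"
  by (rule bounded_linear_intro[where K=B])
     (auto intro!: ell2_eqI simp: coord_diag[OF m] norm_diag_le[OF m] algebra_simps mult.commute[of _ B])

lemma tail_small:
  assumes "0 < e"
  obtains F where "finite F" "\<And>G. finite G \<Longrightarrow> (\<Sum>i\<in>G - F. (cmod (coord x i))\<^sup>2) \<le> e"
proof -
  obtain F where F: "finite F" "dist (\<Sum>i\<in>F. (cmod (coord x i))\<^sup>2) ((norm x)\<^sup>2) \<le> e"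
    using infsum_finite_approximation[OF summable_coord[of x] assms] unfolding norm_ell2_sq by auto
  have "(\<Sum>i\<in>G - F. (cmod (coord x i))\<^sup>2) \<le> e" if "finite G" for G
    using F sum_coord_le[of "F \<union> (G - F)" x] that
      sum.union_disjoint[of F "G - F" "\<lambda>i. (cmod (coord x i))\<^sup>2"]
    by (auto simp: dist_real_def)
  with F that show thesis by blast
qed

text \<open>Dominated convergence: finitely many coordinates carry almost all of \<open>x\<close>
  and are handled by pointwise convergence of the symbol; on the tail the uniform bound
  \<open>B\<close> suffices.\<close>

lemma tendsto_diag:
  fixes x :: "'a ell2"
  assumes m: "\<And>t i. cmod (m t i) \<le> B" and lim: "\<And>i. ((\<lambda>t. m t i) \<longlongrightarrow> 0) net"
  shows "((\<lambda>t. diag (m t) x) \<longlongrightarrow> 0) net"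
proof (rule tendstoI)
  fix e :: real assume e: "0 < e"
  have B: "0 \<le> B" using m[of undefined undefined] norm_ge_zero order_trans by blast
  \<comment> \<open>Head and tail each receive \<open>e\<^sup>2 / 4\<close>, so the total stays
    strictly below \<open>e\<^sup>2\<close>. Adding 1 avoids a zero denominator when
    \<open>B = 0\<close>.\<close>
  define d where "d = e\<^sup>2 / (4 * (B\<^sup>2 + 1))"
  have "0 < B\<^sup>2 + 1" by (simp add: add_nonneg_pos)
  then have d: "0 < d" "B\<^sup>2 * d \<le> e\<^sup>2 / 4"
    using e by (auto simp: d_def field_simps)
  obtain F where F: "finite F" "\<And>G. finite G \<Longrightarrow> (\<Sum>i\<in>G - F. (cmod (coord x i))\<^sup>2) \<le> d"
    using tail_small[OF d(1), of x] by blast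
  have "((\<lambda>t. \<Sum>i\<in>F. (cmod (m t i))\<^sup>2 * (cmod (coord x i))\<^sup>2) \<longlongrightarrow> (\<Sum>i\<in>F. (cmod 0)\<^sup>2 * (cmod (coord x i))\<^sup>2)) net"
    by (intro tendsto_intros lim)
  then have "((\<lambda>t. \<Sum>i\<in>F. (cmod (m t i))\<^sup>2 * (cmod (coord x i))\<^sup>2) \<longlongrightarrow> 0) net"
    by simp
  then have "\<forall>\<^sub>F t in net. (\<Sum>i\<in>F. (cmod (m t i))\<^sup>2 * (cmod (coord x i))\<^sup>2) < e\<^sup>2 / 4"
    by (rule order_tendstoD) (use e in auto)
  then show "\<forall>\<^sub>F t in net. dist (diag (m t) x) 0 < e"
  proof eventually_elim
    case (elim t)
    have "norm (diag (m t) x) \<le> sqrt (e\<^sup>2 / 2)"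
    proof (rule norm_ell2_leI)
      fix G :: "'a set" assume G: "finite G"
      let ?f = "\<lambda>i. (cmod (m t i))\<^sup>2 * (cmod (coord x i))\<^sup>2"
      have "(\<Sum>i\<in>G. (cmod (coord (diag (m t) x) i))\<^sup>2) = sum ?f G"
        by (simp add: coord_diag[OF m] norm_mult power_mult_distrib)
      also have "\<dots> = sum ?f (G \<inter> F) + sum ?f (G - F)"
        using G by (simp add: sum.Int_Diff)
      also have "sum ?f (G \<inter> F) \<le> sum ?f F"
        using F by (intro sum_mono2) auto
      also have "sum ?f (G - F) \<le> (\<Sum>i\<in>G - F. B\<^sup>2 * (cmod (coord x i))\<^sup>2)"
        by (intro sum_mono mult_right_mono power_mono m) auto
      also have "\<dots> \<le> B\<^sup>2 * d"
        unfolding sum_distrib_left[symmetric] by (intro mult_left_mono F G) auto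
      finally show "(\<Sum>i\<in>G. (cmod (coord (diag (m t) x) i))\<^sup>2) \<le> (sqrt (e\<^sup>2 / 2))\<^sup>2"
        using elim d(2) by simp
    qed simp
    also have "\<dots> < e"
      using e by (intro real_less_lsqrt) auto
    finally show ?case by (simp add: dist_norm)
  qed
qed

section \<open>Globally Lipschitz integral equations\<close>

lemma integral_has_vector_derivative_atLeast:
  fixes f :: "real \<Rightarrow> 'a::banach"
  assumes "continuous_on {0..} f" "0 \<le> t"
  shows "((\<lambda>t. integral {0..t} f) has_vector_derivative f t) (at t within {0..})"
proof -
  \<comment> \<open>The right endpoint only has to lie beyond \<open>t\<close>, so that the interval
    and the half-line agree near \<open>t\<close>.\<close>
  have "((\<lambda>t. integral {0..t} f) has_vector_derivative f t) (at t within {0..t + 1})"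
    by (rule integral_has_vector_derivative) (use assms in \<open>auto intro: continuous_on_subset\<close>)
  moreover have "at t within {0..t + 1} = at t within {0..}"
    by (rule at_within_nhd[of t "{..<t + 1}"]) auto
  ultimately show ?thesis by simp
qed

lemma continuous_on_integral_atLeast:
  fixes f :: "real \<Rightarrow> 'a::banach"
  assumes "continuous_on {0..} f"
  shows "continuous_on {0..} (\<lambda>t. integral {0..t} f)"
  unfolding continuous_on_eq_continuous_within
  using integral_has_vector_derivative_atLeast[OF assms] has_vector_derivative_continuous by fastforce

text \<open>One integration gains a factor \<open>1 / K\<close> against the weight
  \<open>exp (K * s)\<close>; the contractions below come from this gain.\<close>

lemma norm_integral_exp_le:
  fixes f :: "real \<Rightarrow> 'a::banach"
  assumes f: "continuous_on {0..t} f" and "0 < K" "0 \<le> t" "0 \<le> c"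
    and le: "\<And>s. 0 \<le> s \<Longrightarrow> s \<le> t \<Longrightarrow> norm (f s) \<le> c * exp (K * s)"
  shows "norm (integral {0..t} f) \<le> c / K * exp (K * t)"
proof -
  have I: "((\<lambda>s. c * exp (K * s)) has_integral (c / K * exp (K * t) - c / K * exp (K * 0))) {0..t}"
    by (rule fundamental_theorem_of_calculus)
       (use assms in \<open>auto simp flip: has_real_derivative_iff_has_vector_derivative intro!: derivative_eq_intros\<close>)
  have "norm (integral {0..t} f) \<le> integral {0..t} (\<lambda>s. c * exp (K * s))"
    by (rule integral_norm_bound_integral)
       (use f I le in \<open>auto intro: integrable_continuous_real\<close>)
  also have "\<dots> \<le> c / K * exp (K * t)"
    unfolding integral_unique[OF I] using assms by simp
  finally show ?thesis .
qed

text \<open>The next two lemmas rest on Bielecki's norm: weighting time by \<open>exp (- 2 * L * t)\<close> makes the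
  integral operator a contraction with factor \<open>1 / 2\<close> on the whole half-line.\<close>

lemma integral_equation_unique:
  fixes G :: "real \<Rightarrow> 'a::banach \<Rightarrow> 'a"
  assumes cont: "\<And>u. continuous_on {0..} u \<Longrightarrow> continuous_on {0..} (\<lambda>t. G t (u t))"
    and lip: "\<And>t x y. 0 \<le> t \<Longrightarrow> norm (G t x - G t y) \<le> L * norm (x - y)" and L: "0 < L"
    and u: "continuous_on {0..} u" "\<And>t. 0 \<le> t \<Longrightarrow> u t = v + integral {0..t} (\<lambda>s. G s (u s))"
    and w: "continuous_on {0..} w" "\<And>t. 0 \<le> t \<Longrightarrow> w t = v + integral {0..t} (\<lambda>s. G s (w s))"
    and T: "0 \<le> T"
  shows "u T = w T"
proof -
  define K where "K = 2 * L"
  define d where "d = (\<lambda>s. exp (- (K * s)) * norm (u s - w s))"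
  have K: "0 < K" using L by (simp add: K_def)
  have uw: "continuous_on {0..T} u" "continuous_on {0..T} w"
    using u(1) w(1) by (auto intro: continuous_on_subset)
  have "continuous_on {0..T} d" unfolding d_def by (intro continuous_intros uw)
  \<comment> \<open>At a maximum point \<open>t\<close> of the weighted difference \<open>d\<close>,
    the integral estimate yields \<open>d t \<le> d t / 2\<close>, which forces \<open>d\<close> to
    vanish.\<close>
  then obtain t where t: "0 \<le> t" "t \<le> T" "\<And>s. 0 \<le> s \<Longrightarrow> s \<le> T \<Longrightarrow> d s \<le> d t"
    using continuous_attains_sup[of "{0..T}" d] T by force
  have le: "norm (u s - w s) \<le> d t * exp (K * s)" if "0 \<le> s" "s \<le> t" for s
  proof -
    have "norm (u s - w s) = d s * exp (K * s)" by (simp add: d_def exp_minus)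
    also have "\<dots> \<le> d t * exp (K * s)" using t that by (intro mult_right_mono) auto
    finally show ?thesis .
  qed
  have Gc: "continuous_on {0..t} (\<lambda>s. G s (u s))" "continuous_on {0..t} (\<lambda>s. G s (w s))"
    using cont[OF u(1)] cont[OF w(1)] by (auto intro: continuous_on_subset)
  have "u t - w t = integral {0..t} (\<lambda>s. G s (u s) - G s (w s))"
    using u(2)[OF t(1)] w(2)[OF t(1)] Gc
    by (subst integral_diff) (auto intro: integrable_continuous_real)
  also have "norm \<dots> \<le> L * d t / K * exp (K * t)"
  proof (rule norm_integral_exp_le)
    show "norm (G s (u s) - G s (w s)) \<le> L * d t * exp (K * s)" if "0 \<le> s" "s \<le> t" for s
      using order_trans[OF lip[OF that(1)] mult_left_mono[OF le[OF that], of L]] L by (simp add: mult.assoc)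
    show "0 \<le> L * d t" using L by (simp add: d_def)
  qed (use Gc K t in \<open>auto intro!: continuous_intros\<close>)
  finally have "exp (- (K * t)) * norm (u t - w t) \<le> exp (- (K * t)) * (L * d t / K * exp (K * t))"
    by (intro mult_left_mono) auto
  moreover have "exp (- (K * t)) * (L * d t / K * exp (K * t)) = d t / 2"
    using L by (simp add: K_def exp_minus)
  moreover have "d t = exp (- (K * t)) * norm (u t - w t)"
    by (simp add: d_def)
  ultimately have "d t \<le> d t / 2"
    by metis
  then have "d T \<le> 0" using t(3)[of T] T by simp
  then show ?thesis by (simp add: d_def mult_le_0_iff)
qed

lemma integral_equation_exists:
  fixes G :: "real \<Rightarrow> 'a::banach \<Rightarrow> 'a"
  assumes cont: "\<And>u. continuous_on {0..} u \<Longrightarrow> continuous_on {0..} (\<lambda>t. G t (u t))"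
    and lip: "\<And>t x y. 0 \<le> t \<Longrightarrow> norm (G t x - G t y) \<le> L * norm (x - y)" and L: "0 < L"
    and zero: "\<And>t. 0 \<le> t \<Longrightarrow> G t 0 = 0"
  obtains u where "continuous_on {0..} u"
    "\<And>t. 0 \<le> t \<Longrightarrow> u t = v + integral {0..t} (\<lambda>s. G s (u s))"
proof -
  define K where "K = 2 * L"
  have K: "0 < K" using L by (simp add: K_def)
  \<comment> \<open>The unknown is rescaled: \<open>w t\<close> stands for
    \<open>exp (- (K * t)) *\<^sub>R u t\<close>, which stays bounded, and \<open>g w\<close> is the
    integrand expressed through \<open>w\<close>.\<close>
  define g where "g = (\<lambda>(w :: real \<Rightarrow>\<^sub>C 'a) s. G s (exp (K * s) *\<^sub>R w s))"
  \<comment> \<open>Bounded continuous functions live on the whole line; \<open>max 0 t\<close>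
    extends the operator constantly to negative times.\<close>
  define H where "H = (\<lambda>w t. exp (- (K * max 0 t)) *\<^sub>R (v + integral {0..max 0 t} (g w)))"
  have gc: "continuous_on {0..} (g w)" for w
    unfolding g_def by (intro cont continuous_intros continuous_on_apply_bcontfun)
  have gc': "continuous_on {0..t} (g w)" for w t
    by (rule continuous_on_subset[OF gc]) auto
  have gi: "g w integrable_on {0..t}" for w t
    by (rule integrable_continuous_real[OF gc'])
  have Hdiff: "norm (H w t - H w' t) \<le> dist w w' / 2" for w w' t
  proof -
    define r where "r = max 0 t"
    have r: "0 \<le> r" by (simp add: r_def)
    have "norm (integral {0..r} (\<lambda>s. g w s - g w' s)) \<le> L * dist w w' / K * exp (K * r)"
    proof (rule norm_integral_exp_le)
      fix s :: real assume s: "0 \<le> s" "s \<le> r"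
      have "norm (g w s - g w' s) \<le> L * (exp (K * s) * norm (w s - w' s))"
        using lip[OF s(1), of "exp (K * s) *\<^sub>R w s" "exp (K * s) *\<^sub>R w' s"]
        by (simp add: g_def flip: scaleR_diff_right)
      also have "\<dots> \<le> L * (exp (K * s) * dist w w')"
        using dist_bounded[of w s w'] L by (intro mult_left_mono) (auto simp: dist_norm)
      finally show "norm (g w s - g w' s) \<le> L * dist w w' * exp (K * s)"
        by (simp add: mult_ac)
    qed (use K L r in \<open>auto intro!: continuous_intros gc'\<close>)
    then have "exp (- (K * r)) * norm (integral {0..r} (\<lambda>s. g w s - g w' s))
        \<le> exp (- (K * r)) * (L * dist w w' / K * exp (K * r))"
      by (intro mult_left_mono) auto
    moreover have "exp (- (K * r)) * (L * dist w w' / K * exp (K * r)) = dist w w' / 2"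
      using L by (simp add: K_def exp_minus)
    moreover have "H w t - H w' t = exp (- (K * r)) *\<^sub>R integral {0..r} (\<lambda>s. g w s - g w' s)"
      using integral_diff[OF gi[of w r] gi[of w' r]]
      by (simp add: H_def r_def[symmetric] flip: scaleR_diff_right)
    ultimately show ?thesis by (simp only: norm_scaleR abs_exp_cancel)
  qed
  \<comment> \<open>Since \<open>G t 0 = 0\<close>, the image of zero is bounded; with
    \<open>Hdiff\<close> this bounds every \<open>H w\<close>.\<close>
  have H0: "H 0 t = exp (- (K * max 0 t)) *\<^sub>R v" for t
  proof -
    have "integral {0..max 0 t} (g 0) = integral {0..max 0 t} (\<lambda>_. 0)"
      by (rule integral_cong) (auto simp: g_def zero)
    then show ?thesis by (simp add: H_def)
  qed
  have "H w \<in> bcontfun" for w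
  proof -
    have "continuous_on UNIV (\<lambda>t. integral {0..max 0 t} (g w))"
      by (rule continuous_on_compose2[OF continuous_on_integral_atLeast[OF gc[of w]]])
         (auto intro!: continuous_intros)
    then have "continuous_on UNIV (H w)"
      unfolding H_def by (intro continuous_intros)
    moreover have "norm (H w t) \<le> norm v + dist w 0 / 2" for t
    proof -
      have "norm (H 0 t) \<le> 1 * norm v"
        unfolding H0 norm_scaleR using K by (intro mult_right_mono) auto
      then show ?thesis
        using Hdiff[of w t 0] norm_triangle_sub[of "H w t" "H 0 t"] by simp
    qed
    ultimately show ?thesis
      unfolding bcontfun_def bounded_iff by auto
  qed
  then have app: "apply_bcontfun (Bcontfun (H w)) = H w" for w
    by (rule Bcontfun_inverse)
  have "dist (Bcontfun (H w)) (Bcontfun (H w')) \<le> 1 / 2 * dist w w'" for w w'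
    by (rule dist_bound) (use Hdiff[of w _ w'] in \<open>simp add: app dist_norm[of "H _ _"]\<close>)
  then have "\<exists>!w. Bcontfun (H w) = w"
    by (intro banach_fix_type[of "1 / 2"]) auto
  then obtain w where "Bcontfun (H w) = w" by blast
  then have w: "w t = H w t" for t using app[of w] by simp
  define u where "u = (\<lambda>t. exp (K * t) *\<^sub>R w t)"
  show thesis
  proof
    show "continuous_on {0..} u" unfolding u_def by (intro continuous_intros continuous_on_apply_bcontfun)
    show "u t = v + integral {0..t} (\<lambda>s. G s (u s))" if "0 \<le> t" for t
    proof -
      have "u t = v + integral {0..t} (g w)"
        using that by (simp add: u_def w[of t] H_def exp_minus)
      then show ?thesis by (simp add: g_def u_def)
    qed
  qed
qed

section \<open>Quasi-resonant quartets\<close>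

definition resonance_set :: "real \<Rightarrow> real \<Rightarrow> real \<Rightarrow> (lattice \<times> lattice \<times> lattice \<times> lattice) set" where
  "resonance_set \<omega> \<Lambda> \<tau> = {(k1, k2, k3, k4). quasi_resonant \<omega> \<Lambda> \<tau> k1 k2 k3 k4}"

text \<open>The disjunctions say that both products in \<open>eigenval_defect\<close> vanish. If
  they single out different points, \<open>k1\<close>, \<open>k2\<close> and \<open>k3\<close>,
  \<open>k4\<close> are the two diagonals of a rectangle; if the same one, the pairs coincide up to
  order.\<close>

definition axis_rectangles :: "(lattice \<times> lattice \<times> lattice \<times> lattice) set" where
  "axis_rectangles = {(k1, k2, k3, k4). k1 + k2 = k3 + k4 \<and>
     (fst k1 = fst k3 \<or> fst k1 = fst k4) \<and> (snd k1 = snd k3 \<or> snd k1 = snd k4)}"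

lemma sqnorm_nonneg: "0 \<le> sqnorm k"
  by (simp add: sqnorm_def)

lemma sqnorm_ge_1:
  assumes "k \<noteq> 0"
  shows "1 \<le> sqnorm k"
proof -
  have "1 \<le> x\<^sup>2" if "x \<noteq> 0" for x :: int
    using that by (simp add: int_one_le_iff_zero_less)
  moreover have "fst k \<noteq> 0 \<or> snd k \<noteq> 0" using assms by (simp add: prod_eq_iff)
  ultimately have "1 \<le> (fst k)\<^sup>2 + (snd k)\<^sup>2"
    by (smt (verit) zero_le_power2)
  then have "real_of_int 1 \<le> real_of_int ((fst k)\<^sup>2 + (snd k)\<^sup>2)"
    by (simp only: of_int_le_iff)
  then show ?thesis by (simp add: sqnorm_def)
qed

lemma finite_sqnorm_le: "finite {k. sqnorm k \<le> R}"
proof (rule finite_subset)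
  have le: "\<bar>n\<bar> \<le> \<lceil>R\<rceil>" if "(real_of_int n)\<^sup>2 \<le> R" for n
  proof -
    have "\<bar>n\<bar> \<le> n\<^sup>2" using abs_le_square_iff[of 1 n] self_le_power[of "\<bar>n\<bar>" 2] by (cases "n = 0") auto
    then have "real_of_int \<bar>n\<bar> \<le> real_of_int (n\<^sup>2)" by (simp only: of_int_le_iff)
    then have "real_of_int \<bar>n\<bar> \<le> R" using that by simp
    then show ?thesis by linarith
  qed
  show "{k. sqnorm k \<le> R} \<subseteq> {- \<lceil>R\<rceil>..\<lceil>R\<rceil>} \<times> {- \<lceil>R\<rceil>..\<lceil>R\<rceil>}"
  proof
    fix k assume "k \<in> {k. sqnorm k \<le> R}"
    then have "(real_of_int (fst k))\<^sup>2 \<le> R" "(real_of_int (snd k))\<^sup>2 \<le> R"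
      unfolding sqnorm_def mem_Collect_eq
      using zero_le_power2[of "real_of_int (fst k)"] zero_le_power2[of "real_of_int (snd k)"]
      by linarith+
    then have "\<bar>fst k\<bar> \<le> \<lceil>R\<rceil>" "\<bar>snd k\<bar> \<le> \<lceil>R\<rceil>" using le by auto
    then show "k \<in> {- \<lceil>R\<rceil>..\<lceil>R\<rceil>} \<times> {- \<lceil>R\<rceil>..\<lceil>R\<rceil>}" by (cases k) auto
  qed
qed auto

text \<open>Each coordinate contributes \<open>a\<^sup>2 + (c + d - a)\<^sup>2 - c\<^sup>2 -
  d\<^sup>2 = 2 * (a - c) * (a - d)\<close>.\<close>

lemma eigenval_defect:
  assumes "k1 + k2 = k3 + k4"
  shows "eigenval \<omega> k1 + eigenval \<omega> k2 - eigenval \<omega> k3 - eigenval \<omega> k4 =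
    2 * (of_int ((fst k1 - fst k3) * (fst k1 - fst k4))
       + \<omega>\<^sup>2 * of_int ((snd k1 - snd k3) * (snd k1 - snd k4)))"
proof -
  have k2: "k2 = k3 + k4 - k1" using assms by (simp add: algebra_simps)
  show ?thesis
    unfolding k2 eigenval_def by (simp add: power2_eq_square algebra_simps)
qed

text \<open>Only finitely many fractions approximate \<open>x\<close> this well, and by
  irrationality none of them gives the value zero, so the smallest of these values is a positive
  gap.\<close>

lemma generic_irrational_gap:
  assumes gen: "generic_irrational x" and C: "0 < C" and \<sigma>: "0 < \<sigma>"
  obtains \<mu> where "0 < \<mu>" "\<And>p q :: int. p \<noteq> 0 \<or> q \<noteq> 0 \<Longrightarrow>
    (q \<noteq> 0 \<Longrightarrow> \<bar>of_int p + x * of_int q\<bar> \<le> C / \<bar>of_int q\<bar> powr (1 + \<sigma>)) \<Longrightarrow> \<mu> \<le> \<bar>of_int p + x * of_int q\<bar>"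
proof -
  define B where "B = {(p :: int, q :: int). 0 < q \<and> \<bar>of_int p / of_int q - x\<bar> \<le> C / of_int q powr (2 + \<sigma>)}"
  define h where "h = (\<lambda>(p :: int, q :: int). \<bar>of_int p - x * of_int q\<bar>)"
  \<comment> \<open>The inserted 1 settles the case \<open>q = 0\<close>, where the value is a
    nonzero integer, and keeps the set nonempty.\<close>
  define \<mu> where "\<mu> = Min (insert 1 (h ` B))"
  have fin: "finite B" using gen C \<sigma> unfolding generic_irrational_def B_def by blast
  have "0 < h b" if "b \<in> B" for b
  proof -
    obtain p q where b: "b = (p, q)" by (cases b)
    with that have "0 < q" by (simp add: B_def)
    have "x \<noteq> of_int p / of_int q"
      using gen Rats_divide[OF Rats_of_int Rats_of_int, of p q]
      unfolding generic_irrational_def by blast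
    then show ?thesis using \<open>0 < q\<close> by (simp add: h_def b field_simps)
  qed
  then have "0 < \<mu>" unfolding \<mu>_def using fin by (subst Min_gr_iff) auto
  moreover have "\<mu> \<le> \<bar>of_int p + x * of_int q\<bar>"
    if pq: "p \<noteq> 0 \<or> q \<noteq> 0"
      and le: "q \<noteq> 0 \<Longrightarrow> \<bar>of_int p + x * of_int q\<bar> \<le> C / \<bar>of_int q\<bar> powr (1 + \<sigma>)" for p q :: int
  proof (cases "q = 0")
    case True
    then have "1 \<le> \<bar>p\<bar>" using pq by auto
    then have "1 \<le> \<bar>real_of_int p\<bar>" by linarith
    moreover have "\<mu> \<le> 1" unfolding \<mu>_def using fin by simp
    ultimately show ?thesis using True by simp
  next
    case False
    \<comment> \<open>Changes of sign that make the denominator positive and turn the sum into a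
      difference, as in the definition of \<open>generic_irrational\<close>.\<close>
    define p' q' where "p' = - sgn q * p" and "q' = \<bar>q\<bar>"
    have q': "0 < q'" using False by (simp add: q'_def)
    have eq: "\<bar>of_int p' - x * of_int q'\<bar> = \<bar>of_int p + x * of_int q\<bar>"
      using False by (cases "0 < q") (auto simp: p'_def q'_def sgn_if abs_if)
    have "\<bar>of_int p' / of_int q' - x\<bar> = \<bar>of_int p' - x * of_int q'\<bar> / of_int q'"
    proof -
      have "of_int p' / of_int q' - x = (of_int p' - x * of_int q') / of_int q'"
        using q' by (simp add: diff_divide_distrib)
      then show ?thesis using q' by (simp add: abs_divide)
    qed
    also have "\<dots> \<le> (C / \<bar>of_int q\<bar> powr (1 + \<sigma>)) / of_int q'"
      unfolding eq using le False q' by (intro divide_right_mono) auto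
    also have "\<dots> = C / of_int q' powr (2 + \<sigma>)"
    proof -
      have "of_int q' powr (2 + \<sigma>) = real_of_int q' powr 1 * of_int q' powr (1 + \<sigma>)"
        by (subst powr_add[symmetric]) simp
      then show ?thesis using q' by (simp add: q'_def mult.commute)
    qed
    finally have "(p', q') \<in> B" using q' by (simp add: B_def)
    then have "\<mu> \<le> h (p', q')" unfolding \<mu>_def using fin by (intro Min_le) auto
    then show ?thesis using eq by (simp add: h_def)
  qed
  ultimately show thesis by (rule that)
qed

text \<open>Serves to bound the product \<open>q\<close> of a quartet by twice its total size; two
  applications of the arithmetic-geometric mean inequality.\<close>

lemma abs_mult_diff_le:
  fixes a b c :: real
  shows "\<bar>(a - b) * (a - c)\<bar> \<le> 2 * a\<^sup>2 + b\<^sup>2 + c\<^sup>2"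
proof -
  have sq: "(a - y)\<^sup>2 \<le> 2 * a\<^sup>2 + 2 * y\<^sup>2" for y
    using sum_squares_bound[of a "- y"] by (simp add: power2_diff)
  have "2 * \<bar>(a - b) * (a - c)\<bar> \<le> (a - b)\<^sup>2 + (a - c)\<^sup>2"
    using sum_squares_bound[of "\<bar>a - b\<bar>" "\<bar>a - c\<bar>"] by (simp add: abs_mult)
  then show ?thesis using sq[of b] sq[of c] by linarith
qed

text \<open>Because \<open>\<bar>q\<bar> \<le> 2 * N\<close>, a defect that is small in terms of the
  size \<open>N\<close> is also small in terms of \<open>q\<close>, so the Diophantine gap applies.
  Comparing the gap with the defect bound limits \<open>N\<close>.\<close>

lemma finite_non_rectangles:
  assumes gen: "generic_irrational (\<omega>\<^sup>2)" and \<Lambda>: "0 < \<Lambda>" and \<tau>: "0 < \<tau>"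
  shows "finite (resonance_set \<omega> \<Lambda> \<tau> - axis_rectangles)"
proof -
  \<comment> \<open>This constant is what remains after replacing \<open>N\<close> by
    \<open>\<bar>q\<bar> / 2\<close> in half the defect bound:
    \<open>2 powr (1 + \<tau>) / 2 = 2 powr \<tau>\<close>.\<close>
  have "0 < \<Lambda> * 2 powr \<tau>" using \<Lambda> by simp
  from generic_irrational_gap[OF gen this \<tau>] obtain \<mu> where \<mu>: "0 < \<mu>"
    and gap: "\<And>p q :: int. p \<noteq> 0 \<or> q \<noteq> 0 \<Longrightarrow>
      (q \<noteq> 0 \<Longrightarrow> \<bar>of_int p + \<omega>\<^sup>2 * of_int q\<bar> \<le> \<Lambda> * 2 powr \<tau> / \<bar>of_int q\<bar> powr (1 + \<tau>)) \<Longrightarrow>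
      \<mu> \<le> \<bar>of_int p + \<omega>\<^sup>2 * of_int q\<bar>" by blast
  define S where "S = {k. sqnorm k \<le> \<Lambda> / (2 * \<mu>)}"
  have "resonance_set \<omega> \<Lambda> \<tau> - axis_rectangles \<subseteq> S \<times> S \<times> S \<times> S"
  proof safe
    fix k1 k2 k3 k4
    assume res: "(k1, k2, k3, k4) \<in> resonance_set \<omega> \<Lambda> \<tau>" and nr: "(k1, k2, k3, k4) \<notin> axis_rectangles"
    define N where "N = sqnorm k1 + sqnorm k2 + sqnorm k3 + sqnorm k4"
    define p where "p = (fst k1 - fst k3) * (fst k1 - fst k4)"
    define q where "q = (snd k1 - snd k3) * (snd k1 - snd k4)"
    \<comment> \<open>The zero quartet is a degenerate rectangle; outside it the defect bound is
      available and \<open>N\<close> is at least 1.\<close>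
    have nz: "\<not> (k1 = 0 \<and> k2 = 0 \<and> k3 = 0 \<and> k4 = 0)"
      using nr by (auto simp: axis_rectangles_def)
    with res have "k1 + k2 - k3 - k4 = 0"
      and defect: "\<bar>eigenval \<omega> k1 + eigenval \<omega> k2 - eigenval \<omega> k3 - eigenval \<omega> k4\<bar>
        \<le> \<Lambda> / N powr (1 + \<tau>)"
      unfolding resonance_set_def quasi_resonant_def N_def by blast+
    then have sum: "k1 + k2 = k3 + k4" by (simp add: algebra_simps)
    have small: "\<bar>2 * (of_int p + \<omega>\<^sup>2 * of_int q)\<bar> \<le> \<Lambda> / N powr (1 + \<tau>)"
      using defect unfolding eigenval_defect[OF sum] p_def q_def .
    have N1: "1 \<le> N"
      using nz sqnorm_ge_1[of k1] sqnorm_ge_1[of k2] sqnorm_ge_1[of k3] sqnorm_ge_1[of k4]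
        sqnorm_nonneg[of k1] sqnorm_nonneg[of k2] sqnorm_nonneg[of k3] sqnorm_nonneg[of k4]
      unfolding N_def by linarith
    have small': "\<bar>of_int p + \<omega>\<^sup>2 * of_int q\<bar> \<le> \<Lambda> / (2 * N powr (1 + \<tau>))"
      using small by (simp add: abs_mult)
    have "\<mu> \<le> \<bar>of_int p + \<omega>\<^sup>2 * of_int q\<bar>"
    proof (rule gap)
      show "p \<noteq> 0 \<or> q \<noteq> 0"
        using nr sum by (auto simp: axis_rectangles_def p_def q_def)
      assume "q \<noteq> 0"
      have "\<bar>real_of_int q\<bar> / 2 \<le> N"
      proof -
        have "\<bar>real_of_int q\<bar> \<le> 2 * (real_of_int (snd k1))\<^sup>2 + (real_of_int (snd k3))\<^sup>2 + (real_of_int (snd k4))\<^sup>2"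
          using abs_mult_diff_le[of "real_of_int (snd k1)" "real_of_int (snd k3)" "real_of_int (snd k4)"]
          by (simp add: q_def)
        also have "\<dots> \<le> 2 * sqnorm k1 + sqnorm k3 + sqnorm k4"
          by (simp add: sqnorm_def)
        also have "\<dots> \<le> 2 * N"
          unfolding N_def using sqnorm_nonneg[of k2] sqnorm_nonneg[of k3] sqnorm_nonneg[of k4] by simp
        finally show ?thesis by simp
      qed
      then have "(\<bar>real_of_int q\<bar> / 2) powr (1 + \<tau>) \<le> N powr (1 + \<tau>)"
        using \<tau> by (intro powr_mono2) auto
      then have "\<Lambda> / (2 * N powr (1 + \<tau>)) \<le> \<Lambda> / (2 * (\<bar>real_of_int q\<bar> / 2) powr (1 + \<tau>))"
        using \<Lambda> \<open>q \<noteq> 0\<close> N1 by (intro divide_left_mono mult_left_mono mult_pos_pos) auto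
      also have "\<dots> = \<Lambda> * 2 powr \<tau> / \<bar>real_of_int q\<bar> powr (1 + \<tau>)"
        by (simp add: powr_divide powr_add)
      finally show "\<bar>of_int p + \<omega>\<^sup>2 * of_int q\<bar> \<le> \<Lambda> * 2 powr \<tau> / \<bar>of_int q\<bar> powr (1 + \<tau>)"
        using small' by simp
    qed
    \<comment> \<open>As \<open>N\<close> is at least 1, the exponent may be lowered to 1, which
      leaves an inequality that is linear in \<open>N\<close>.\<close>
    also have "\<dots> \<le> \<Lambda> / (2 * N)"
    proof -
      have "N powr 1 \<le> N powr (1 + \<tau>)" using N1 \<tau> by (intro powr_mono) auto
      then have "\<Lambda> / (2 * N powr (1 + \<tau>)) \<le> \<Lambda> / (2 * N)"
        using \<Lambda> N1 by (intro divide_left_mono mult_left_mono) auto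
      then show ?thesis using small' by simp
    qed
    finally have "N \<le> \<Lambda> / (2 * \<mu>)" using \<mu> N1 by (simp add: field_simps)
    then show "k1 \<in> S" "k2 \<in> S" "k3 \<in> S" "k4 \<in> S"
      using sqnorm_nonneg[of k1] sqnorm_nonneg[of k2] sqnorm_nonneg[of k3] sqnorm_nonneg[of k4]
      by (auto simp: S_def N_def)
  qed
  moreover have "finite (S \<times> S \<times> S \<times> S)" unfolding S_def by (intro finite_cartesian_product finite_sqnorm_le)
  ultimately show ?thesis by (rule finite_subset)
qed

section \<open>Comparison of weights within a quartet\<close>

lemma bracket_ge_1: "1 \<le> bracket k"
  using sqnorm_nonneg[of k] by (simp add: bracket_def)

lemma bracket_sq: "(bracket k)\<^sup>2 = sqnorm k + 1"
  using sqnorm_nonneg[of k] by (simp add: bracket_def)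

text \<open>In a rectangle each coordinate of \<open>k4\<close> is one of \<open>k1\<close> or of
  \<open>k2\<close>, hence \<open>sqnorm k4 \<le> sqnorm k1 + sqnorm k2\<close>. The finitely many
  other quartets are absorbed into the constant.\<close>

lemma bracket_dominated:
  assumes fin: "finite (resonance_set \<omega> \<Lambda> \<tau> - axis_rectangles)"
  obtains C where "1 \<le> C" "\<And>k1 k2 k3 k4. (k1, k2, k3, k4) \<in> resonance_set \<omega> \<Lambda> \<tau> \<Longrightarrow>
    bracket k4 \<le> C * bracket (if sqnorm k2 \<le> sqnorm k1 then k1 else k2)"
proof -
  let ?E = "resonance_set \<omega> \<Lambda> \<tau> - axis_rectangles"
  \<comment> \<open>The 2 serves the rectangles; the sum dominates every exceptional
    \<open>bracket k4\<close>, and \<open>bracket\<close> is at least 1 on the other side.\<close>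
  define C where "C = 2 + (\<Sum>(k1, k2, k3, k4) \<in> ?E. bracket k4)"
  have b0: "0 \<le> bracket k" for k using bracket_ge_1[of k] by linarith
  then have C2: "2 \<le> C" unfolding C_def using b0 by (simp add: sum_nonneg case_prod_beta)
  have "bracket k4 \<le> C * bracket (if sqnorm k2 \<le> sqnorm k1 then k1 else k2)"
    if res: "(k1, k2, k3, k4) \<in> resonance_set \<omega> \<Lambda> \<tau>" for k1 k2 k3 k4
  proof -
    define k where "k = (if sqnorm k2 \<le> sqnorm k1 then k1 else k2)"
    have "bracket k4 \<le> C * bracket k"
    proof (cases "(k1, k2, k3, k4) \<in> axis_rectangles")
      case True
      then have "fst k4 = fst k1 \<or> fst k4 = fst k2" "snd k4 = snd k1 \<or> snd k4 = snd k2"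
        unfolding axis_rectangles_def by (force simp: prod_eq_iff)+
      then have "sqnorm k4 \<le> sqnorm k1 + sqnorm k2"
        unfolding sqnorm_def by (elim disjE) simp_all
      then have "(bracket k4)\<^sup>2 \<le> (2 * bracket k)\<^sup>2"
        using sqnorm_nonneg[of k1] sqnorm_nonneg[of k2] by (simp add: power_mult_distrib bracket_sq k_def)
      then have "bracket k4 \<le> 2 * bracket k" by (rule power2_le_imp_le) (use b0[of k] in auto)
      also have "\<dots> \<le> C * bracket k" using C2 b0[of k] by (intro mult_right_mono) auto
      finally show ?thesis .
    next
      case False
      then have "bracket k4 \<le> (\<Sum>(k1, k2, k3, k4) \<in> ?E. bracket k4)"
        using member_le_sum[of "(k1, k2, k3, k4)" ?E "\<lambda>(k1, k2, k3, k4). bracket k4"] res fin b0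
        by (simp add: case_prod_beta)
      also have "\<dots> \<le> C" by (simp add: C_def)
      also have "\<dots> \<le> C * bracket k" using C2 bracket_ge_1[of k] by simp
      finally show ?thesis .
    qed
    then show "bracket k4 \<le> C * bracket (if sqnorm k2 \<le> sqnorm k1 then k1 else k2)"
      by (simp only: k_def)
  qed
  with C2 show thesis by (intro that[of C]) auto
qed

section \<open>Bounded cubic operators\<close>

text \<open>Boundedness of the quadrilinear form is demanded on finite sets of quartets, so that it
  presupposes no convergence. Summability and the bound on the cubic operator follow from it by
  duality.\<close>

locale quartet_form =
  fixes Q :: "('a \<times> 'a \<times> 'a \<times> 'a) set" and A :: real
  assumes A_nonneg: "0 \<le> A"
    and form_le: "\<And>P a b d e. finite P \<Longrightarrow> P \<subseteq> Q \<Longrightarrow>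
      (\<Sum>(k1, k2, k3, k4)\<in>P. cmod (coord a k1) * cmod (coord b k2) * cmod (coord d k3) * cmod (coord e k4))
        \<le> A * norm a * norm b * norm d * norm e"
begin

definition fiber :: "'a \<Rightarrow> ('a \<times> 'a \<times> 'a) set" where
  "fiber k = {(k1, k2, k3). (k1, k2, k3, k) \<in> Q}"

definition majorant :: "'a ell2 \<Rightarrow> 'a ell2 \<Rightarrow> 'a ell2 \<Rightarrow> 'a \<times> 'a \<times> 'a \<Rightarrow> real" where
  "majorant a b d = (\<lambda>(k1, k2, k3). cmod (coord a k1) * cmod (coord b k2) * cmod (coord d k3))"

lemma majorant_nonneg: "0 \<le> majorant a b d p"
  by (auto simp: majorant_def case_prod_beta)

lemma finite_form_le:
  assumes "finite P" "P \<subseteq> Sigma K fiber"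
  shows "(\<Sum>(k, p)\<in>P. majorant a b d p * cmod (coord e k)) \<le> A * norm a * norm b * norm d * norm e"
proof -
  let ?h = "\<lambda>(k, (k1, k2, k3)). (k1, k2, k3, k)"
  have inj: "inj_on ?h P" by (auto simp: inj_on_def)
  have "(\<Sum>(k1, k2, k3, k4)\<in>?h ` P. cmod (coord a k1) * cmod (coord b k2) * cmod (coord d k3) * cmod (coord e k4))
      \<le> A * norm a * norm b * norm d * norm e"
    by (rule form_le) (use assms in \<open>auto simp: fiber_def\<close>)
  then show ?thesis
    by (subst (asm) sum.reindex[OF inj]) (simp add: case_prod_beta comp_def majorant_def)
qed

lemma form_summable:
  "(\<lambda>(k, p). majorant a b d p * cmod (coord e k)) summable_on Sigma K fiber"
  by (rule summable_nonnegI[OF _ finite_form_le]) (auto simp: majorant_nonneg)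

lemma form_infsum_le:
  "(\<Sum>\<^sub>\<infinity>(k, p)\<in>Sigma K fiber. majorant a b d p * cmod (coord e k)) \<le> A * norm a * norm b * norm d * norm e"
  by (rule infsum_le_finite_sums[OF form_summable]) (rule finite_form_le)

text \<open>Testing the form with the unit vector at \<open>k\<close> isolates the fiber over
  \<open>k\<close>.\<close>

lemma majorant_summable: "majorant a b d summable_on fiber k"
proof -
  define e where "e = Abs_ell2 (\<lambda>i. if i = k then 1 else 0 :: complex)"
  have "coord e = (\<lambda>i. if i = k then 1 else 0)"
    unfolding e_def
    by (rule coord_Abs_ell2[where B=1]) (auto simp: if_distrib[of cmod] if_distrib[of "\<lambda>x. x\<^sup>2"] cong: if_cong)
  then show ?thesis
    using summable_on_SigmaD1[OF form_summable[of a b d e "{k}"], of k] by simp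
qed

text \<open>Duality: with the fiber sums over \<open>K\<close> themselves as the fourth argument,
  the form equals their square sum \<open>S\<close>, so \<open>S \<le> ?B * sqrt S\<close>.\<close>

lemma majorant_sum_sq_le:
  assumes K: "finite K"
  shows "(\<Sum>k\<in>K. (infsum (majorant a b d) (fiber k))\<^sup>2) \<le> (A * norm a * norm b * norm d)\<^sup>2"
proof -
  let ?B = "A * norm a * norm b * norm d"
  define M where "M = (\<lambda>k. infsum (majorant a b d) (fiber k))"
  define S where "S = (\<Sum>k\<in>K. (M k)\<^sup>2)"
  define e where "e = Abs_ell2 (\<lambda>i. if i \<in> K then of_real (M i) else 0 :: complex)"
  have sub: "(\<Sum>i\<in>F. (cmod (if i \<in> K then of_real (M i) else 0))\<^sup>2) \<le> S" if "finite F" for F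
  proof -
    have "(\<Sum>i\<in>F. (cmod (if i \<in> K then of_real (M i) else 0))\<^sup>2) = (\<Sum>i\<in>F \<inter> K. (M i)\<^sup>2)"
      using that by (intro sum.mono_neutral_cong_right) auto
    also have "\<dots> \<le> S" unfolding S_def by (intro sum_mono2 K) auto
    finally show ?thesis .
  qed
  have S0: "0 \<le> S" unfolding S_def by (simp add: sum_nonneg)
  have M0: "0 \<le> M k" for k unfolding M_def by (rule infsum_nonneg) (rule majorant_nonneg)
  have Mk: "infsum (majorant a b d) (fiber k) = M k" for k by (simp add: M_def)
  have ce: "coord e = (\<lambda>i. if i \<in> K then of_real (M i) else 0)"
    unfolding e_def by (rule coord_Abs_ell2[OF sub])
  have norm_e: "norm e \<le> sqrt S"
    by (rule norm_ell2_leI) (use sub S0 in \<open>auto simp: ce\<close>)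
  have "S = (\<Sum>\<^sub>\<infinity>k\<in>K. \<Sum>\<^sub>\<infinity>p\<in>fiber k. majorant a b d p * cmod (coord e k))"
    unfolding infsum_finite[OF K] S_def
    by (rule sum.cong) (auto simp: ce Mk infsum_cmult_left majorant_summable power2_eq_square M0)
  also have "\<dots> = (\<Sum>\<^sub>\<infinity>(k, p)\<in>Sigma K fiber. majorant a b d p * cmod (coord e k))"
    using infsum_Sigma_banach[OF form_summable[of a b d e K]] by simp
  also have "\<dots> \<le> ?B * norm e" by (rule form_infsum_le)
  also have "\<dots> \<le> ?B * sqrt S" using A_nonneg norm_e by (intro mult_left_mono) auto
  finally have "sqrt S * sqrt S \<le> ?B * sqrt S" using S0 by simp
  then have "sqrt S \<le> ?B"
    using mult_right_le_imp_le[of "sqrt S" "sqrt S" ?B] S0 A_nonneg by (cases "S = 0") auto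
  then have "(sqrt S)\<^sup>2 \<le> ?B\<^sup>2" using S0 by (intro power_mono) auto
  then show ?thesis using S0 by (simp add: S_def M_def)
qed

text \<open>Coefficients may depend on the whole quartet. This permits selecting some of the
  quartets and inserting ratios of weights while keeping a single operator.\<close>

definition coeff_le :: "('a \<Rightarrow> 'a \<Rightarrow> 'a \<Rightarrow> 'a \<Rightarrow> complex) \<Rightarrow> real \<Rightarrow> bool" where
  "coeff_le c C \<longleftrightarrow> 0 \<le> C \<and> (\<forall>(k1, k2, k3, k4)\<in>Q. cmod (c k1 k2 k3 k4) \<le> C)"

definition term3 where
  "term3 c a b d k = (\<lambda>(k1, k2, k3). c k1 k2 k3 k * (coord a k1 * coord b k2 * cnj (coord d k3)))"

definition tri :: "('a \<Rightarrow> 'a \<Rightarrow> 'a \<Rightarrow> 'a \<Rightarrow> complex) \<Rightarrow> 'a ell2 \<Rightarrow> 'a ell2 \<Rightarrow> 'a ell2 \<Rightarrow> 'a ell2" where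
  "tri c a b d = Abs_ell2 (\<lambda>k. \<Sum>\<^sub>\<infinity>p\<in>fiber k. term3 c a b d k p)"

context
  fixes c C assumes c: "coeff_le c C"
begin

lemma cmod_term3_le: "p \<in> fiber k \<Longrightarrow> cmod (term3 c a b d k p) \<le> C * majorant a b d p"
  using c by (auto simp: coeff_le_def fiber_def term3_def majorant_def norm_mult intro!: mult_right_mono)

lemma term3_abs_summable: "(\<lambda>p. cmod (term3 c a b d k p)) summable_on fiber k"
  by (rule summable_on_comparison_test[OF summable_on_cmult_right[OF majorant_summable, of C a b d]])
     (auto intro: cmod_term3_le)

lemma term3_summable: "term3 c a b d k summable_on fiber k"
  by (rule abs_summable_summable[OF term3_abs_summable])

lemma cmod_infsum_term3_le:
  "cmod (infsum (term3 c a b d k) (fiber k)) \<le> C * infsum (majorant a b d) (fiber k)"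
proof -
  have "cmod (infsum (term3 c a b d k) (fiber k)) \<le> (\<Sum>\<^sub>\<infinity>p\<in>fiber k. cmod (term3 c a b d k p))"
    by (rule norm_infsum_bound[OF term3_abs_summable])
  also have "\<dots> \<le> (\<Sum>\<^sub>\<infinity>p\<in>fiber k. C * majorant a b d p)"
    by (rule infsum_mono[OF term3_abs_summable summable_on_cmult_right[OF majorant_summable]])
       (rule cmod_term3_le)
  also have "\<dots> = C * infsum (majorant a b d) (fiber k)"
    by (rule infsum_cmult_right) (rule majorant_summable)
  finally show ?thesis .
qed

lemma infsum_term3_sum_sq_le:
  assumes "finite K"
  shows "(\<Sum>k\<in>K. (cmod (infsum (term3 c a b d k) (fiber k)))\<^sup>2) \<le> (C * (A * norm a * norm b * norm d))\<^sup>2"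
proof -
  have "(\<Sum>k\<in>K. (cmod (infsum (term3 c a b d k) (fiber k)))\<^sup>2)
      \<le> (\<Sum>k\<in>K. C\<^sup>2 * (infsum (majorant a b d) (fiber k))\<^sup>2)"
    unfolding power_mult_distrib[symmetric]
    by (intro sum_mono power_mono cmod_infsum_term3_le) simp
  also have "\<dots> \<le> C\<^sup>2 * (A * norm a * norm b * norm d)\<^sup>2"
    unfolding sum_distrib_left[symmetric]
    by (intro mult_left_mono majorant_sum_sq_le assms) simp
  finally show ?thesis by (simp add: power_mult_distrib)
qed

lemma coord_tri: "coord (tri c a b d) k = infsum (term3 c a b d k) (fiber k)"
  unfolding tri_def by (subst coord_Abs_ell2[OF infsum_term3_sum_sq_le]) auto

lemma norm_tri_le: "norm (tri c a b d) \<le> C * A * norm a * norm b * norm d"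
proof (rule norm_ell2_leI)
  show "0 \<le> C * A * norm a * norm b * norm d"
    using c A_nonneg by (simp add: coeff_le_def)
  show "(\<Sum>i\<in>F. (cmod (coord (tri c a b d) i))\<^sup>2) \<le> (C * A * norm a * norm b * norm d)\<^sup>2" if "finite F" for F
    using infsum_term3_sum_sq_le[OF that, of a b d] by (simp add: coord_tri mult.assoc)
qed

text \<open>Additivity is reduced to an identity between terms, so one proof serves all three
  slots.\<close>

lemma tri_cong_linear:
  assumes "\<And>k p. term3 c a b d k p = term3 c a' b' d' k p + term3 c a'' b'' d'' k p"
  shows "tri c a b d = tri c a' b' d' + tri c a'' b'' d''"
proof (rule ell2_eqI)
  fix k
  have "term3 c a b d k = (\<lambda>p. term3 c a' b' d' k p + term3 c a'' b'' d'' k p)"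
    using assms by auto
  then show "coord (tri c a b d) k = coord (tri c a' b' d' + tri c a'' b'' d'') k"
    by (simp add: coord_tri infsum_add[OF term3_summable term3_summable])
qed

lemma tri_telescope:
  "tri c a b d - tri c a' b' d' = tri c (a - a') b d + tri c a' (b - b') d + tri c a' b' (d - d')"
proof -
  have "tri c a b d = tri c (a - a') b d + tri c a' b d"
    by (rule tri_cong_linear) (auto simp: term3_def algebra_simps)
  moreover have "tri c a' b d = tri c a' (b - b') d + tri c a' b' d"
    by (rule tri_cong_linear) (auto simp: term3_def algebra_simps)
  moreover have "tri c a' b' d = tri c a' b' (d - d') + tri c a' b' d'"
    by (rule tri_cong_linear) (auto simp: term3_def algebra_simps)
  ultimately show ?thesis by simp
qed

lemma norm_tri_diff_le:
  "norm (tri c a b d - tri c a' b' d') \<le> C * A * (norm (a - a') * norm b * norm d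
      + norm a' * norm (b - b') * norm d + norm a' * norm b' * norm (d - d'))"
proof -
  have "norm (tri c a b d - tri c a' b' d') \<le> C * A * norm (a - a') * norm b * norm d
      + C * A * norm a' * norm (b - b') * norm d + C * A * norm a' * norm b' * norm (d - d')"
    unfolding tri_telescope by (intro norm_triangle_le add_mono norm_tri_le)
  then show ?thesis by (simp add: algebra_simps)
qed

text \<open>Real scalars pass through the conjugated slot. This lets a radial cutoff be pulled out
  of the cubic term as a scalar.\<close>

lemma tri_scaleR: "tri c (r *\<^sub>R a) (r *\<^sub>R b) (r *\<^sub>R d) = r ^ 3 *\<^sub>R tri c a b d"
proof (rule ell2_eqI)
  fix k
  have "term3 c (r *\<^sub>R a) (r *\<^sub>R b) (r *\<^sub>R d) k = (\<lambda>p. of_real (r ^ 3) * term3 c a b d k p)"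
    by (auto simp: term3_def fun_eq_iff power3_eq_cube)
  then show "coord (tri c (r *\<^sub>R a) (r *\<^sub>R b) (r *\<^sub>R d)) k = coord (r ^ 3 *\<^sub>R tri c a b d) k"
    by (simp only: coord_tri coord_simps) (rule infsum_cmult_right, rule term3_summable)
qed

lemma tendsto_tri:
  assumes "(f \<longlongrightarrow> a) F" "(g \<longlongrightarrow> b) F" "(h \<longlongrightarrow> d) F"
  shows "((\<lambda>t. tri c (f t) (g t) (h t)) \<longlongrightarrow> tri c a b d) F"
proof (rule Lim_null_comparison[THEN LIM_zero_cancel])
  let ?R = "\<lambda>t. C * A * (norm (f t - a) * norm (g t) * norm (h t)
      + norm a * norm (g t - b) * norm (h t) + norm a * norm b * norm (h t - d))"
  show "\<forall>\<^sub>F t in F. norm (tri c (f t) (g t) (h t) - tri c a b d) \<le> ?R t"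
    by (intro always_eventually allI norm_tri_diff_le)
  have "(?R \<longlongrightarrow> C * A * (norm (a - a) * norm b * norm d
      + norm a * norm (b - b) * norm d + norm a * norm b * norm (d - d))) F"
    by (intro tendsto_intros assms)
  then show "(?R \<longlongrightarrow> 0) F" by simp
qed

lemma continuous_on_tri:
  assumes "continuous_on T f" "continuous_on T g" "continuous_on T h"
  shows "continuous_on T (\<lambda>t. tri c (f t) (g t) (h t))"
  using assms unfolding continuous_on_def by (auto intro: tendsto_tri)

end

text \<open>The quartic sum \<open>W\<close> equals its own conjugate under the exchange of
  \<open>(k1, k2)\<close> with \<open>(k3, k4)\<close>. So \<open>W\<close> is real, and the inner
  product is the real part of the imaginary number \<open>c0 * W\<close>.\<close>

lemma tri_inner_eq_0:
  assumes sym: "\<And>k1 k2 k3 k4. (k1, k2, k3, k4) \<in> Q \<Longrightarrow> (k3, k4, k1, k2) \<in> Q"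
    and c0: "Re c0 = 0"
  shows "z \<bullet> tri (\<lambda>_ _ _ _. c0) z z z = 0"
proof -
  let ?c = "\<lambda>_ _ _ _. c0"
  let ?g = "\<lambda>(k, (k1, k2, k3)). coord z k1 * coord z k2 * cnj (coord z k3) * cnj (coord z k)"
  let ?Q = "Sigma UNIV fiber"
  have c: "coeff_le ?c (cmod c0)" by (auto simp: coeff_le_def)
  have g: "?g summable_on ?Q"
  proof (rule abs_summable_summable)
    show "(\<lambda>x. cmod (?g x)) summable_on ?Q"
      using form_summable[of z z z z UNIV]
      by (simp add: case_prod_beta' norm_mult majorant_def)
  qed
  then have cg: "(\<lambda>x. c0 * ?g x) summable_on ?Q" by (rule summable_on_cmult_right)
  define W where "W = infsum ?g ?Q"
  \<comment> \<open>The fourth index is stored first, so this map is the exchange of the two pairs;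
    it is an involution.\<close>
  have "W = infsum (\<lambda>x. cnj (?g x)) ?Q"
    unfolding W_def
    by (rule infsum_reindex_bij_witness[where i="\<lambda>(k4, (k1, k2, k3)). (k2, (k3, k4, k1))"
          and j="\<lambda>(k4, (k1, k2, k3)). (k2, (k3, k4, k1))"])
       (auto simp: fiber_def mult_ac dest: sym)
  then have W: "W = cnj W" unfolding infsum_cnj W_def .
  have tm: "term3 ?c z z z k p * cnj (coord z k) = c0 * ?g (k, p)" for k p
    by (cases p) (simp add: term3_def)
  have "(\<Sum>\<^sub>\<infinity>k. coord (tri ?c z z z) k * cnj (coord z k)) = (\<Sum>\<^sub>\<infinity>k. \<Sum>\<^sub>\<infinity>p\<in>fiber k. c0 * ?g (k, p))"
    by (intro infsum_cong) (simp add: coord_tri[OF c] term3_summable[OF c] infsum_cmult_left[symmetric] tm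
        del: case_prod_conv)
  also have "\<dots> = infsum (\<lambda>x. c0 * ?g x) ?Q"
    by (rule infsum_Sigma_banach[OF cg])
  also have "\<dots> = c0 * W" unfolding W_def by (rule infsum_cmult_right) (rule g)
  finally have sum: "(\<Sum>\<^sub>\<infinity>k. coord (tri ?c z z z) k * cnj (coord z k)) = c0 * W" .
  have "(\<lambda>k. \<Sum>\<^sub>\<infinity>p\<in>fiber k. c0 * ?g (k, p)) summable_on UNIV"
    by (rule summable_on_Sigma_banach) (use cg in \<open>simp add: case_prod_beta'\<close>)
  then have summ: "(\<lambda>k. coord (tri ?c z z z) k * cnj (coord z k)) summable_on UNIV"
    by (rule summable_on_cong[THEN iffD1, rotated])
       (simp add: coord_tri[OF c] term3_summable[OF c] infsum_cmult_left[symmetric] tm del: case_prod_conv)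
  have "z \<bullet> tri ?c z z z = (\<Sum>\<^sub>\<infinity>k. Re (coord (tri ?c z z z) k * cnj (coord z k)))"
    unfolding inner_ell2_eq by (rule infsum_cong) (simp add: inner_complex_def mult.commute)
  also have "\<dots> = Re (c0 * W)"
    using infsum_Re[OF summ] sum by simp
  also have "\<dots> = 0"
    using W c0 by (simp add: complex_eq_iff)
  finally show ?thesis .
qed

end

section \<open>The Cauchy-Schwarz bound on rectangles\<close>

lemma sum_products_le:
  assumes "finite P" "inj_on (\<lambda>x. (f x, g x)) P"
  shows "(\<Sum>x\<in>P. (cmod (coord a (f x)) * cmod (coord b (g x)))\<^sup>2) \<le> (norm a * norm b)\<^sup>2"
proof -
  let ?h = "\<lambda>(i, j). (cmod (coord a i))\<^sup>2 * (cmod (coord b j))\<^sup>2"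
  have "(\<Sum>x\<in>P. (cmod (coord a (f x)) * cmod (coord b (g x)))\<^sup>2) = sum ?h ((\<lambda>x. (f x, g x)) ` P)"
    by (subst sum.reindex[OF assms(2)]) (simp add: power_mult_distrib)
  also have "\<dots> \<le> sum ?h (f ` P \<times> g ` P)"
    using assms by (intro sum_mono2) auto
  also have "\<dots> = (\<Sum>i\<in>f ` P. (cmod (coord a i))\<^sup>2) * (\<Sum>j\<in>g ` P. (cmod (coord b j))\<^sup>2)"
    by (simp add: sum_product sum.cartesian_product)
  also have "\<dots> \<le> (norm a)\<^sup>2 * (norm b)\<^sup>2"
    using assms by (intro mult_mono sum_coord_le sum_nonneg) auto
  finally show ?thesis by (simp add: power_mult_distrib)
qed

text \<open>Cauchy-Schwarz with the factors grouped as \<open>(k1, k2)\<close> and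
  \<open>(k3, k4)\<close>. Each pair occurs at most once, so each square sum is part of a product of
  two squared norms.\<close>

lemma bi_injective_form_le:
  assumes P: "finite P" and inj: "inj_on (\<lambda>(k1, k2, k3, k4). (k1, k2)) P"
    "inj_on (\<lambda>(k1, k2, k3, k4). (k3, k4)) P"
  shows "(\<Sum>(k1, k2, k3, k4)\<in>P. cmod (coord a k1) * cmod (coord b k2) * cmod (coord d k3) * cmod (coord e k4))
    \<le> norm a * norm b * norm d * norm e"
proof -
  let ?f = "\<lambda>x. cmod (coord a (fst x)) * cmod (coord b (fst (snd x)))"
  let ?g = "\<lambda>x. cmod (coord d (fst (snd (snd x)))) * cmod (coord e (snd (snd (snd x))))"
  have "(\<Sum>x\<in>P. (?f x)\<^sup>2) \<le> (norm a * norm b)\<^sup>2"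
    by (rule sum_products_le[OF P]) (use inj(1) in \<open>simp add: case_prod_beta'\<close>)
  then have f: "L2_set ?f P \<le> norm a * norm b"
    unfolding L2_set_def by (intro real_le_lsqrt) (auto simp: sum_nonneg)
  have "(\<Sum>x\<in>P. (?g x)\<^sup>2) \<le> (norm d * norm e)\<^sup>2"
    by (rule sum_products_le[OF P]) (use inj(2) in \<open>simp add: case_prod_beta'\<close>)
  then have g: "L2_set ?g P \<le> norm d * norm e"
    unfolding L2_set_def by (intro real_le_lsqrt) (auto simp: sum_nonneg)
  have "(\<Sum>(k1, k2, k3, k4)\<in>P. cmod (coord a k1) * cmod (coord b k2) * cmod (coord d k3) * cmod (coord e k4))
      = (\<Sum>x\<in>P. \<bar>?f x\<bar> * \<bar>?g x\<bar>)"
    by (simp add: case_prod_beta' abs_mult mult.assoc)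
  also have "\<dots> \<le> L2_set ?f P * L2_set ?g P"
    by (rule L2_set_mult_ineq)
  also have "\<dots> \<le> (norm a * norm b) * (norm d * norm e)"
    by (intro mult_mono f g) auto
  finally show ?thesis by (simp add: mult.assoc)
qed

text \<open>Each of the four families of rectangles contributes 1 to the constant, and so does each
  exceptional quartet, since every coordinate is at most the norm. The families may overlap, which
  is harmless for nonnegative terms.\<close>

lemma quartet_form_resonance_set:
  assumes fin: "finite (resonance_set \<omega> \<Lambda> \<tau> - axis_rectangles)"
  shows "quartet_form (resonance_set \<omega> \<Lambda> \<tau>) (4 + card (resonance_set \<omega> \<Lambda> \<tau> - axis_rectangles))"
proof
  let ?E = "resonance_set \<omega> \<Lambda> \<tau> - axis_rectangles"
  fix P :: "(lattice \<times> lattice \<times> lattice \<times> lattice) set" and a b d e :: "lattice ell2"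
  assume P: "finite P" "P \<subseteq> resonance_set \<omega> \<Lambda> \<tau>"
  define f where "f = (\<lambda>(k1, k2, k3, k4). cmod (coord a k1) * cmod (coord b k2) * cmod (coord d k3) * cmod (coord e k4))"
  define N where "N = norm a * norm b * norm d * norm e"
  have f0: "0 \<le> f x" for x by (simp add: f_def case_prod_beta)
  have fN: "f x \<le> N" for x
    unfolding f_def N_def case_prod_beta by (intro mult_mono coord_le_norm) auto
  have Un: "sum f (A \<union> B) \<le> sum f A + sum f B" if "finite A" "finite B" for A B
    using sum.union_inter[OF that, of f] sum_nonneg[of "A \<inter> B" f] f0 by simp
  \<comment> \<open>\<open>X\<close> and \<open>Y\<close> choose whether \<open>k1\<close> shares
    its first and its second coordinate with \<open>k3\<close> or with \<open>k4\<close>. For a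
    fixed choice, either pair determines the other.\<close>
  define R where "R = (\<lambda>X Y. {(k1, k2, k3, k4) \<in> P. k1 + k2 = k3 + k4 \<and>
      (if X then fst k1 = fst k3 else fst k1 = fst k4) \<and> (if Y then snd k1 = snd k3 else snd k1 = snd k4)})"
  have R: "finite (R X Y)" for X Y unfolding R_def by (rule finite_subset[OF _ P(1)]) auto
  have RN: "sum f (R X Y) \<le> N" for X Y
    unfolding f_def N_def
    by (rule bi_injective_form_le[OF R])
       (auto simp: inj_on_def R_def prod_eq_iff split: if_splits)
  have EN: "sum f (P \<inter> ?E) \<le> card ?E * N"
  proof -
    have "sum f (P \<inter> ?E) \<le> sum f ?E" by (intro sum_mono2 fin f0) auto
    also have "\<dots> \<le> (\<Sum>x\<in>?E. N)" by (intro sum_mono fN)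
    finally show ?thesis by simp
  qed
  have "P \<subseteq> (R True True \<union> R True False) \<union> (R False True \<union> R False False) \<union> (P \<inter> ?E)"
    using P(2) by (auto simp: R_def axis_rectangles_def)
  then have "sum f P \<le> sum f ((R True True \<union> R True False) \<union> (R False True \<union> R False False) \<union> (P \<inter> ?E))"
    using P fin R f0 by (intro sum_mono2) auto
  also have "\<dots> \<le> ((N + N) + (N + N)) + card ?E * N"
    by (intro order_trans[OF Un] add_mono RN EN) (use R fin in auto)
  finally show "(\<Sum>(k1, k2, k3, k4)\<in>P. cmod (coord a k1) * cmod (coord b k2) * cmod (coord d k3) * cmod (coord e k4))
      \<le> (4 + card ?E) * norm a * norm b * norm d * norm e"
    by (simp add: f_def N_def algebra_simps)
qed simp

section \<open>The cubic flow in the interaction picture\<close>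

text \<open>The unitary group generated by the linear part of the equation.\<close>

definition phase :: "('a \<Rightarrow> real) \<Rightarrow> real \<Rightarrow> 'a ell2 \<Rightarrow> 'a ell2" where
  "phase lam t = diag (\<lambda>k. cis (t * lam k))"

lemma coord_phase [simp]: "coord (phase lam t x) k = cis (t * lam k) * coord x k"
  unfolding phase_def by (rule coord_diag[where B=1]) simp

lemma phase_phase [simp]: "phase lam s (phase lam t x) = phase lam (s + t) x"
  by (rule ell2_eqI) (simp add: cis_mult algebra_simps flip: mult.assoc)

lemma phase_0 [simp]: "phase lam 0 x = x"
  by (rule ell2_eqI) simp

lemma bounded_linear_phase: "bounded_linear (phase lam t)"
  unfolding phase_def by (rule bounded_linear_diag[where B=1]) simp

lemmas phase_linear = bounded_linear.linear[OF bounded_linear_phase]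

lemma phase_diff: "phase lam t (x - y) = phase lam t x - phase lam t y"
  by (rule linear_diff[OF phase_linear])

lemma phase_scaleR: "phase lam t (r *\<^sub>R x) = r *\<^sub>R phase lam t x"
  by (rule linear_cmul[OF phase_linear])

lemma norm_phase [simp]: "norm (phase lam t x) = norm x"
  by (simp add: norm_ell2_eq norm_mult)

lemma inner_phase: "phase lam t x \<bullet> y = x \<bullet> phase lam (- t) y"
proof -
  have "(cis a * p) \<bullet> q = p \<bullet> (cis (- a) * q)" for a p q
    by (simp add: inner_complex_def algebra_simps)
  then show ?thesis by (simp add: inner_ell2_eq)
qed

text \<open>For unbounded \<open>lam\<close> the group need not be continuous in operator norm. The
  moving vector is handled by the isometry, the moving time on a fixed vector by
  \<open>tendsto_diag\<close>.\<close>

lemma tendsto_phase: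
  assumes f: "(f \<longlongrightarrow> x) F" and g: "(g \<longlongrightarrow> t) F"
  shows "((\<lambda>s. phase lam (g s) (f s)) \<longlongrightarrow> phase lam t x) F"
proof (rule LIM_zero_cancel)
  define m where "m = (\<lambda>s k. cis (g s * lam k) - cis (t * lam k))"
  have m2: "cmod (m s k) \<le> 2" for s k
    unfolding m_def using norm_triangle_ineq4[of "cis (g s * lam k)" "cis (t * lam k)"] by simp
  have "((\<lambda>s. m s k) \<longlongrightarrow> cis (t * lam k) - cis (t * lam k)) F" for k
    unfolding m_def cis_conv_exp by (intro tendsto_intros g)
  then have "((\<lambda>s. diag (m s) x) \<longlongrightarrow> 0) F"
    by (intro tendsto_diag[OF m2]) simp
  moreover have "((\<lambda>s. phase lam (g s) (f s - x)) \<longlongrightarrow> 0) F"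
    by (rule tendsto_norm_zero_cancel) (use tendsto_norm_zero[OF LIM_zero[OF f]] in simp)
  ultimately have "((\<lambda>s. phase lam (g s) (f s - x) + diag (m s) x) \<longlongrightarrow> 0 + 0) F"
    by (intro tendsto_add)
  moreover have "phase lam (g s) (f s) - phase lam t x = phase lam (g s) (f s - x) + diag (m s) x" for s
    by (rule ell2_eqI) (simp add: coord_diag[OF m2], simp add: m_def algebra_simps)
  ultimately show "((\<lambda>s. phase lam (g s) (f s) - phase lam t x) \<longlongrightarrow> 0) F" by simp
qed

lemma continuous_on_phase:
  assumes "continuous_on T f" "continuous_on T g"
  shows "continuous_on T (\<lambda>s. phase lam (g s) (f s))"
  using assms unfolding continuous_on_def by (auto intro: tendsto_phase)

section \<open>The radial retraction onto a ball, and conservation of the norm\<close>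

definition radial_cutoff :: "real \<Rightarrow> 'a::real_normed_vector \<Rightarrow> 'a" where
  "radial_cutoff M x = (M / max M (norm x)) *\<^sub>R x"

lemma radial_cutoff_id: "0 < M \<Longrightarrow> norm x \<le> M \<Longrightarrow> radial_cutoff M x = x"
  by (simp add: radial_cutoff_def max_def)

lemma norm_radial_cutoff_le:
  assumes "0 < M"
  shows "norm (radial_cutoff M x) \<le> M"
proof -
  have "M * norm x \<le> M * max M (norm x)" using assms by (intro mult_left_mono) auto
  then show ?thesis
    using assms by (simp add: radial_cutoff_def pos_divide_le_eq)
qed

text \<open>The difference splits into a change of the vector and a change of the scaling factor,
  each at most \<open>norm (x - y)\<close>.\<close>

lemma radial_cutoff_lipschitz:
  assumes M: "0 < M"
  shows "norm (radial_cutoff M x - radial_cutoff M y) \<le> 2 * norm (x - y)"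
proof -
  define a where "a = max M (norm x)"
  define b where "b = max M (norm y)"
  have ab: "M \<le> a" "M \<le> b" "0 < a" "0 < b" "norm y \<le> b" using M by (auto simp: a_def b_def)
  have "\<bar>b - a\<bar> \<le> \<bar>norm y - norm x\<bar>" by (simp add: a_def b_def)
  also have "\<dots> \<le> norm (x - y)" using norm_triangle_ineq3[of y x] by (simp add: norm_minus_commute)
  finally have d: "\<bar>b - a\<bar> \<le> norm (x - y)" .
  have eq: "radial_cutoff M x - radial_cutoff M y = (M / a) *\<^sub>R (x - y) + ((M / a) * ((b - a) / b)) *\<^sub>R y"
  proof -
    have "M / a - (M / a) * ((b - a) / b) = M / b" using ab by (simp add: field_simps)
    then have "(M / b) *\<^sub>R y = (M / a) *\<^sub>R y - ((M / a) * ((b - a) / b)) *\<^sub>R y"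
      by (simp flip: scaleR_diff_left)
    then show ?thesis by (simp add: radial_cutoff_def a_def[symmetric] b_def[symmetric] scaleR_diff_right)
  qed
  have "norm ((M / a) *\<^sub>R (x - y)) \<le> 1 * norm (x - y)"
    unfolding norm_scaleR using ab M by (intro mult_right_mono) auto
  moreover have "norm (((M / a) * ((b - a) / b)) *\<^sub>R y) \<le> 1 * norm (x - y)"
  proof -
    have "norm (((M / a) * ((b - a) / b)) *\<^sub>R y) = (M / a) * (\<bar>b - a\<bar> * (norm y / b))"
      using ab M by (simp add: abs_mult)
    also have "\<dots> \<le> 1 * (norm (x - y) * 1)"
      using ab M d by (intro mult_mono) auto
    finally show ?thesis by simp
  qed
  ultimately show ?thesis unfolding eq by (intro norm_triangle_le) simp
qed

text \<open>The squared norm has derivative \<open>2 * (y t \<bullet> g t) = 0\<close>.\<close>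

lemma norm_conserved:
  fixes y :: "real \<Rightarrow> 'a::{real_inner, banach}"
  assumes g: "continuous_on {0..} g" and y: "\<And>t. 0 \<le> t \<Longrightarrow> y t = v + integral {0..t} g"
    and orth: "\<And>t. 0 \<le> t \<Longrightarrow> y t \<bullet> g t = 0" and t: "0 \<le> t"
  shows "norm (y t) = norm v"
proof -
  define u where "u = (\<lambda>t. v + integral {0..t} g)"
  have u: "(u has_vector_derivative g t) (at t within {0..})" if "0 \<le> t" for t
    unfolding u_def using integral_has_vector_derivative_atLeast[OF g that]
    by (auto intro!: derivative_eq_intros)
  have "((\<lambda>t. u t \<bullet> u t) has_vector_derivative 0) (at t within {0..})" if "t \<in> {0..}" for t
  proof -
    have "((\<lambda>t. u t \<bullet> u t) has_vector_derivative u t \<bullet> g t + g t \<bullet> u t) (at t within {0..})"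
      using that by (intro bounded_bilinear.has_vector_derivative[OF bounded_bilinear_inner] u) auto
    moreover have "u t \<bullet> g t = 0" using that orth[of t] y[of t] by (simp add: u_def)
    ultimately show ?thesis by (simp add: inner_commute)
  qed
  then obtain c where c: "\<And>t. t \<in> {0..} \<Longrightarrow> u t \<bullet> u t = c"
    using has_vector_derivative_zero_constant[of "{0..}" "\<lambda>t. u t \<bullet> u t"] by auto
  have "u t \<bullet> u t = u 0 \<bullet> u 0" using c[of t] c[of 0] t by simp
  then show ?thesis using y[OF t] by (simp add: u_def norm_eq_sqrt_inner)
qed

section \<open>The flow in the unweighted space\<close>

locale cubic_flow = quartet_form Q A for Q :: "('a \<times> 'a \<times> 'a \<times> 'a) set" and A +
  fixes lam :: "'a \<Rightarrow> real" and c0 :: complex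
  assumes sym: "\<And>k1 k2 k3 k4. (k1, k2, k3, k4) \<in> Q \<Longrightarrow> (k3, k4, k1, k2) \<in> Q"
    and c0: "Re c0 = 0"
begin

abbreviation U where "U \<equiv> phase lam"

definition cubic :: "'a ell2 \<Rightarrow> 'a ell2" where
  "cubic z = tri (\<lambda>_ _ _ _. c0) z z z"

definition field :: "real \<Rightarrow> 'a ell2 \<Rightarrow> 'a ell2" where
  "field t y = U (- t) (cubic (U t y))"

definition cut_field :: "real \<Rightarrow> real \<Rightarrow> 'a ell2 \<Rightarrow> 'a ell2" where
  "cut_field M t y = U (- t) (cubic (radial_cutoff M (U t y)))"

lemma coeff_const: "coeff_le (\<lambda>_ _ _ _. c0) (cmod c0)"
  by (auto simp: coeff_le_def)

lemma inner_field: "y \<bullet> field t y = 0"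
  unfolding field_def inner_phase[symmetric] cubic_def by (rule tri_inner_eq_0[OF sym c0])

text \<open>The cutoff rescales its argument by a real factor, hence the field by its cube. The cut
  field is therefore still orthogonal to \<open>y\<close>, and its flow also conserves the
  norm.\<close>

lemma cut_field_eq: "cut_field M t y = (M / max M (norm y)) ^ 3 *\<^sub>R field t y"
  by (simp add: cut_field_def field_def cubic_def radial_cutoff_def tri_scaleR[OF coeff_const] phase_scaleR)

lemma cut_field_id: "0 < M \<Longrightarrow> norm y \<le> M \<Longrightarrow> cut_field M t y = field t y"
  by (simp add: cut_field_def field_def radial_cutoff_id)

lemma continuous_on_field:
  assumes "continuous_on T f"
  shows "continuous_on T (\<lambda>t. field t (f t))"
  unfolding field_def cubic_def
  by (intro continuous_on_phase continuous_on_tri[OF coeff_const] continuous_intros assms)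

lemma continuous_on_cut_field:
  assumes "continuous_on T f" "0 < M"
  shows "continuous_on T (\<lambda>t. cut_field M t (f t))"
  unfolding cut_field_eq
  by (intro continuous_intros continuous_on_field assms) (use assms(2) in \<open>auto simp: max_def\<close>)

text \<open>The 6 counts three slots, each with the Lipschitz constant 2 of the cutoff. The added 1
  keeps the constant positive when \<open>A\<close> or \<open>c0\<close> vanishes.\<close>

lemma cut_field_lipschitz:
  assumes M: "0 < M"
  shows "norm (cut_field M t x - cut_field M t y) \<le> (6 * cmod c0 * A * M\<^sup>2 + 1) * norm (x - y)"
proof -
  define p q where "p = radial_cutoff M (U t x)" and "q = radial_cutoff M (U t y)"
  have pq: "norm p \<le> M" "norm q \<le> M" by (simp_all add: p_def q_def norm_radial_cutoff_le M)
  have d: "norm (p - q) \<le> 2 * norm (x - y)"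
    unfolding p_def q_def using radial_cutoff_lipschitz[OF M, of "U t x" "U t y"]
    by (simp flip: phase_diff)
  have "norm (cut_field M t x - cut_field M t y) = norm (cubic p - cubic q)"
    by (simp add: cut_field_def p_def q_def flip: phase_diff)
  also have "\<dots> \<le> cmod c0 * A * (norm (p - q) * norm p * norm p
      + norm q * norm (p - q) * norm p + norm q * norm q * norm (p - q))"
    unfolding cubic_def by (rule norm_tri_diff_le[OF coeff_const])
  also have "\<dots> \<le> cmod c0 * A * (2 * norm (x - y) * M * M + M * (2 * norm (x - y)) * M + M * M * (2 * norm (x - y)))"
    using pq d M A_nonneg by (intro mult_left_mono add_mono mult_mono) auto
  also have "\<dots> = 6 * cmod c0 * A * M\<^sup>2 * norm (x - y)"
    by (simp add: power2_eq_square algebra_simps)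
  also have "\<dots> \<le> (6 * cmod c0 * A * M\<^sup>2 + 1) * norm (x - y)"
    by (intro mult_right_mono) auto
  finally show ?thesis .
qed

lemma field_integral_norm:
  assumes "continuous_on {0..} y" "\<And>t. 0 \<le> t \<Longrightarrow> y t = v + integral {0..t} (\<lambda>s. field s (y s))" "0 \<le> t"
  shows "norm (y t) = norm v"
  by (rule norm_conserved[OF continuous_on_field[OF assms(1)] assms(2) inner_field assms(3)])

text \<open>Both solutions keep the norm of \<open>v\<close>, so both solve the cut equation, whose
  field is globally Lipschitz.\<close>

lemma ell2_unique:
  assumes y: "continuous_on {0..} y" "\<And>t. 0 \<le> t \<Longrightarrow> y t = v + integral {0..t} (\<lambda>s. field s (y s))"
    and w: "continuous_on {0..} w" "\<And>t. 0 \<le> t \<Longrightarrow> w t = v + integral {0..t} (\<lambda>s. field s (w s))"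
    and t: "0 \<le> t"
  shows "y t = w t"
proof -
  \<comment> \<open>Any positive radius not below \<open>norm v\<close> serves; the added 1 covers
    \<open>v = 0\<close>.\<close>
  define M where "M = norm v + 1"
  have M: "0 < M" unfolding M_def by (simp add: add_nonneg_pos)
  have cut: "x t = v + integral {0..t} (\<lambda>s. cut_field M s (x s))"
    if x: "continuous_on {0..} x" "\<And>t. 0 \<le> t \<Longrightarrow> x t = v + integral {0..t} (\<lambda>s. field s (x s))" and "0 \<le> t" for x t
  proof -
    have "integral {0..t} (\<lambda>s. field s (x s)) = integral {0..t} (\<lambda>s. cut_field M s (x s))"
      by (rule integral_cong) (use field_integral_norm[OF x] M in \<open>simp add: cut_field_id M_def\<close>)
    then show ?thesis using x(2)[OF \<open>0 \<le> t\<close>] by simp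
  qed
  show ?thesis
  proof (rule integral_equation_unique[OF _ cut_field_lipschitz[OF M] _ y(1) cut[OF y] w(1) cut[OF w] t])
    show "0 < 6 * cmod c0 * A * M\<^sup>2 + 1" using A_nonneg by (simp add: add_nonneg_pos)
  qed (rule continuous_on_cut_field[OF _ M])
qed

text \<open>The solution of the cut equation conserves its norm, stays inside the ball and thus
  solves the original equation.\<close>

lemma ell2_exists:
  obtains y where "continuous_on {0..} y" "\<And>t. 0 \<le> t \<Longrightarrow> y t = v + integral {0..t} (\<lambda>s. field s (y s))"
proof -
  define M where "M = norm v + 1"
  have M: "0 < M" unfolding M_def by (simp add: add_nonneg_pos)
  have "0 < 6 * cmod c0 * A * M\<^sup>2 + 1" using A_nonneg by (simp add: add_nonneg_pos)
  moreover have "cut_field M t 0 = 0" for t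
    using inner_eq_zero_iff[of "field t 0"] norm_tri_le[OF coeff_const, of 0 0 0]
    by (simp add: cut_field_def cubic_def radial_cutoff_def linear_0[OF phase_linear])
  ultimately obtain y where y: "continuous_on {0..} y"
      "\<And>t. 0 \<le> t \<Longrightarrow> y t = v + integral {0..t} (\<lambda>s. cut_field M s (y s))"
    using integral_equation_exists[of "cut_field M" "6 * cmod c0 * A * M\<^sup>2 + 1" v]
      continuous_on_cut_field[OF _ M] cut_field_lipschitz[OF M] by metis
  have orth: "x \<bullet> cut_field M t x = 0" for x t
    unfolding cut_field_eq inner_scaleR_right inner_field by simp
  have "norm (y t) = norm v" if "0 \<le> t" for t
    by (rule norm_conserved[OF continuous_on_cut_field[OF y(1) M] y(2) orth that])
  then have "cut_field M t (y t) = field t (y t)" if "0 \<le> t" for t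
    using that M by (simp add: cut_field_id M_def)
  then have "integral {0..t} (\<lambda>s. cut_field M s (y s)) = integral {0..t} (\<lambda>s. field s (y s))" for t
    by (intro integral_cong) simp
  with y show thesis by (intro that[of y]) auto
qed

text \<open>Along a fixed solution \<open>z\<close> the cubic term is also a linear operator applied to \<open>z\<close>, with
  \<open>z\<close> substituted in the slot of the higher of the first two frequencies.  That operator is bounded
  in the weighted space as well, so the weighted solution exists globally, and uniqueness in the
  unweighted space identifies the two.\<close>

lemma weighted_exists:
  fixes w :: "'a \<Rightarrow> real" and h :: "'a \<Rightarrow> 'a \<Rightarrow> bool"
  assumes w1: "\<And>k. 1 \<le> w k" and C: "0 \<le> C"
    and dom: "\<And>k1 k2 k3 k4. (k1, k2, k3, k4) \<in> Q \<Longrightarrow> w k4 \<le> C * w (if h k1 k2 then k1 else k2)"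
  defines "J \<equiv> diag (\<lambda>k. of_real (1 / w k))"
  obtains u g where "continuous_on {0..} u" "continuous_on {0..} g" "u 0 = v"
    "\<And>t. 0 \<le> t \<Longrightarrow> (u has_vector_derivative g t) (at t within {0..})"
    "\<And>t. 0 \<le> t \<Longrightarrow> J (g t) = field t (J (u t))"
proof -
  have J1: "cmod (of_real (1 / w k)) \<le> 1" for k
    using w1[of k] by (simp add: norm_divide)
  have w0: "w k \<noteq> 0" for k using w1[of k] by auto
  have coord_J: "coord (J x) k = of_real (1 / w k) * coord x k" for x k
    unfolding J_def by (rule coord_diag[OF J1])
  have J_lin: "bounded_linear J" unfolding J_def by (rule bounded_linear_diag[OF J1])
  have J_U: "J (U t x) = U t (J x)" for t x
    by (rule ell2_eqI) (simp add: coord_J)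
  have J_add: "J (x + y) = J x + J y" for x y
    by (rule linear_add[OF bounded_linear.linear[OF J_lin]])
  \<comment> \<open>Here \<open>u\<close> is to represent the weighted solution and
    \<open>J u\<close> the actual sequence, so the unweighted problem starts from
    \<open>J v\<close>.\<close>
  obtain y where y: "continuous_on {0..} y"
      "\<And>t. 0 \<le> t \<Longrightarrow> y t = J v + integral {0..t} (\<lambda>s. field s (y s))"
    using ell2_exists[of "J v"] by blast
  define z where "z = (\<lambda>t. U t (y t))"
  define M where "M = norm (J v)"
  have zM: "norm (z t) = M" if "0 \<le> t" for t
    using field_integral_norm[OF y that] by (simp add: z_def M_def)
  have z: "continuous_on {0..} z" unfolding z_def by (intro continuous_on_phase continuous_intros y)
  \<comment> \<open>Linear over the reals in \<open>x\<close>, with the known solution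
    \<open>z\<close> frozen in the remaining slots.\<close>
  define T where "T = (\<lambda>c c' t x. U (- t) (tri c (U t x) (z t) (z t) + tri c' (z t) (U t x) (z t)))"
  have T_cont: "continuous_on {0..} (\<lambda>t. T c c' t (f t))"
    if "coeff_le c B" "coeff_le c' B" "continuous_on {0..} f" for c c' B f
    unfolding T_def by (intro continuous_on_phase continuous_on_add continuous_on_tri[OF that(1)]
      continuous_on_tri[OF that(2)] continuous_intros z that)
  have T_lip: "norm (T c c' t x - T c c' t x') \<le> (2 * B * A * M\<^sup>2 + 1) * norm (x - x')"
    if c: "coeff_le c B" "coeff_le c' B" and t: "0 \<le> t" for c c' B t x x'
  proof -
    have "norm (T c c' t x - T c c' t x') = norm ((tri c (U t x) (z t) (z t) - tri c (U t x') (z t) (z t))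
        + (tri c' (z t) (U t x) (z t) - tri c' (z t) (U t x') (z t)))"
      by (simp add: T_def algebra_simps flip: phase_diff)
    also have "\<dots> \<le> B * A * (norm (U t x - U t x') * norm (z t) * norm (z t)
        + norm (U t x') * norm (z t - z t) * norm (z t) + norm (U t x') * norm (z t) * norm (z t - z t))
        + B * A * (norm (z t - z t) * norm (U t x) * norm (z t)
        + norm (z t) * norm (U t x - U t x') * norm (z t) + norm (z t) * norm (U t x') * norm (z t - z t))"
      by (intro norm_triangle_le add_mono norm_tri_diff_le c)
    also have "\<dots> = 2 * B * A * M\<^sup>2 * norm (x - x')"
      using zM[OF t] by (simp add: power2_eq_square flip: phase_diff)
    also have "\<dots> \<le> (2 * B * A * M\<^sup>2 + 1) * norm (x - x')"
      by (intro mult_right_mono) auto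
    finally show ?thesis .
  qed
  have T_pos: "0 < 2 * B * A * M\<^sup>2 + 1" if "0 \<le> B" for B
    using that A_nonneg by (simp add: add_nonneg_pos)

  \<comment> \<open>\<open>c1\<close> and \<open>c2\<close> split the quartets according to which of
    the first two frequencies is to carry the weight.\<close>
  define c1 where "c1 = (\<lambda>k1 k2 (k3 :: 'a) (k4 :: 'a). if h k1 k2 then c0 else 0)"
  define c2 where "c2 = (\<lambda>k1 k2 (k3 :: 'a) (k4 :: 'a). if h k1 k2 then 0 else c0)"
  have c12: "coeff_le c1 (cmod c0)" "coeff_le c2 (cmod c0)"
    by (auto simp: coeff_le_def c1_def c2_def)
  \<comment> \<open>Conjugation of the split operators by the weight. By \<open>dom\<close>, the
    ratio is bounded wherever the coefficient is nonzero on \<open>Q\<close>.\<close>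
  define d1 where "d1 = (\<lambda>k1 k2 k3 k4. c1 k1 k2 k3 k4 * of_real (w k4 / w k1))"
  define d2 where "d2 = (\<lambda>k1 k2 k3 k4. c2 k1 k2 k3 k4 * of_real (w k4 / w k2))"
  have ratio: "cmod (of_real (w k4 / w k)) \<le> C" if "w k4 \<le> C * w k" for k k4
    using w1[of k] w1[of k4] that by (simp add: norm_divide pos_divide_le_eq)
  have d12: "coeff_le d1 (cmod c0 * C)" "coeff_le d2 (cmod c0 * C)"
  proof -
    have "cmod (d1 k1 k2 k3 k4) \<le> cmod c0 * C \<and> cmod (d2 k1 k2 k3 k4) \<le> cmod c0 * C"
      if "(k1, k2, k3, k4) \<in> Q" for k1 k2 k3 k4
      using ratio[OF dom[OF that]] C
      by (cases "h k1 k2")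
         (auto simp: d1_def d2_def c1_def c2_def norm_mult simp del: of_real_divide norm_of_real intro!: mult_left_mono)
    then show "coeff_le d1 (cmod c0 * C)" "coeff_le d2 (cmod c0 * C)"
      using C by (auto simp: coeff_le_def)
  qed
  have J_d1: "J (tri d1 a b d) = tri c1 (J a) b d" and J_d2: "J (tri d2 b a d) = tri c2 b (J a) d" for a b d
  proof -
    have e: "term3 c1 (J a) b d k = (\<lambda>p. of_real (1 / w k) * term3 d1 a b d k p)"
      "term3 c2 b (J a) d k = (\<lambda>p. of_real (1 / w k) * term3 d2 b a d k p)" for k
      by (auto simp: term3_def d1_def d2_def coord_J w0)
    show "J (tri d1 a b d) = tri c1 (J a) b d" "J (tri d2 b a d) = tri c2 b (J a) d"
      by (rule ell2_eqI, unfold coord_J coord_tri[OF c12(1)] coord_tri[OF d12(1)] e,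
          rule infsum_cmult_right[symmetric], rule term3_summable[OF d12(1)],
          rule ell2_eqI, unfold coord_J coord_tri[OF c12(2)] coord_tri[OF d12(2)] e,
          rule infsum_cmult_right[symmetric], rule term3_summable[OF d12(2)])
  qed
  \<comment> \<open>\<open>J\<close> intertwines the weighted linear field with the unweighted
    one.\<close>
  have J_T: "J (T d1 d2 t x) = T c1 c2 t (J x)" for t x
    by (simp add: T_def J_U J_add J_d1 J_d2)
  have T_y: "T c1 c2 t (y t) = field t (y t)" for t
  proof -
    have "cubic (z t) = tri c1 (z t) (z t) (z t) + tri c2 (z t) (z t) (z t)"
    proof (rule ell2_eqI)
      fix k
      have "term3 (\<lambda>_ _ _ _. c0) (z t) (z t) (z t) k =
          (\<lambda>p. term3 c1 (z t) (z t) (z t) k p + term3 c2 (z t) (z t) (z t) k p)"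
        by (auto simp: term3_def c1_def c2_def)
      then show "coord (cubic (z t)) k = coord (tri c1 (z t) (z t) (z t) + tri c2 (z t) (z t) (z t)) k"
        by (simp add: cubic_def coord_tri[OF coeff_const] coord_tri[OF c12(1)] coord_tri[OF c12(2)]
            infsum_add[OF term3_summable[OF c12(1)] term3_summable[OF c12(2)]])
    qed
    then show ?thesis by (simp add: T_def field_def z_def)
  qed
  have T0: "T d1 d2 t 0 = 0" for t
    using norm_tri_le[OF d12(1), of 0] norm_tri_le[OF d12(2), of _ 0]
    by (simp add: T_def linear_0[OF phase_linear])
  have C0: "0 \<le> cmod c0 * C" using C by simp
  obtain u where u: "continuous_on {0..} u"
      "\<And>t. 0 \<le> t \<Longrightarrow> u t = v + integral {0..t} (\<lambda>s. T d1 d2 s (u s))"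
    using integral_equation_exists[of "T d1 d2" _ v, OF T_cont[OF d12] T_lip[OF d12] T_pos[OF C0] T0] by blast
  define g where "g = (\<lambda>t. T d1 d2 t (u t))"
  have g: "continuous_on {0..} g" unfolding g_def by (rule T_cont[OF d12 u(1)])
  \<comment> \<open>\<open>J u\<close> and \<open>y\<close> solve the same linear equation with the
    same initial value \<open>J v\<close>.\<close>
  have Ju: "J (u t) = y t" if "0 \<le> t" for t
  proof (rule integral_equation_unique[OF T_cont[OF c12] T_lip[OF c12] T_pos _ _ y(1) _ that])
    show "continuous_on {0..} (\<lambda>t. J (u t))"
      using bounded_linear.continuous_on[OF J_lin u(1)] .
    show "J (u t) = J v + integral {0..t} (\<lambda>s. T c1 c2 s (J (u s)))" if "0 \<le> t" for t
    proof -
      have "g integrable_on {0..t}"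
        by (rule integrable_continuous_real) (rule continuous_on_subset[OF g], auto)
      then have "J (integral {0..t} g) = integral {0..t} (\<lambda>s. J (g s))"
        using integral_linear[OF _ J_lin, of g "{0..t}"] by (simp add: comp_def)
      then show ?thesis
        using u(2)[OF that] by (simp add: J_add g_def J_T)
    qed
    show "y t = J v + integral {0..t} (\<lambda>s. T c1 c2 s (y s))" if "0 \<le> t" for t
      using y(2)[OF that] by (simp add: T_y)
  qed auto
  show thesis
  proof (rule that[OF u(1) g])
    show "u 0 = v" using u(2)[of 0] by simp
    show "J (g t) = field t (J (u t))" if "0 \<le> t" for t
      using that by (simp add: g_def J_T Ju T_y)
    show "(u has_vector_derivative g t) (at t within {0..})" if "0 \<le> t" for t
    proof (rule has_vector_derivative_transform)
      show "((\<lambda>t. v + integral {0..t} g) has_vector_derivative g t) (at t within {0..})"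
        using integral_has_vector_derivative_atLeast[OF g that] by (auto intro!: derivative_eq_intros)
    qed (use that u(2) in \<open>auto simp: g_def\<close>)
  qed
qed

end

section \<open>Weighted sequence spaces and the Cauchy problem\<close>

lemma has_vector_derivative_iff_quotient:
  fixes f :: "real \<Rightarrow> 'a::real_normed_vector"
  shows "(f has_vector_derivative d) (at t within S) \<longleftrightarrow>
    ((\<lambda>s. (1 / (s - t)) *\<^sub>R (f s - f t)) \<longlongrightarrow> d) (at t within S)"
proof -
  have "norm ((f s - f t) - (s - t) *\<^sub>R d) / norm (s - t) = norm ((1 / (s - t)) *\<^sub>R (f s - f t) - d)"
    if "s \<noteq> t" for s
  proof -
    have "(1 / (s - t)) *\<^sub>R (f s - f t) - d = (1 / (s - t)) *\<^sub>R ((f s - f t) - (s - t) *\<^sub>R d)"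
      using that by (simp add: scaleR_diff_right)
    then show ?thesis by simp
  qed
  then have "((\<lambda>s. norm ((f s - f t) - (s - t) *\<^sub>R d) / norm (s - t)) \<longlongrightarrow> 0) (at t within S) \<longleftrightarrow>
      ((\<lambda>s. norm ((1 / (s - t)) *\<^sub>R (f s - f t) - d)) \<longlongrightarrow> 0) (at t within S)"
    by (intro tendsto_cong) (auto simp: eventually_at_filter)
  then show ?thesis
    unfolding has_vector_derivative_def has_derivative_iff_norm
    by (simp add: bounded_linear_scaleR_left tendsto_norm_zero_iff LIM_zero_iff)
qed

text \<open>The chord has length \<open>2 * \<bar>sin ((a - b) / 2)\<bar>\<close>.\<close>

lemma cmod_cis_diff_le: "cmod (cis a - cis b) \<le> \<bar>a - b\<bar>"
proof -
  have "cis a - cis b = cis b * (exp (\<i> * of_real (a - b)) - 1)"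
    by (simp add: right_diff_distrib cis_mult cis_conv_exp[symmetric] del: of_real_diff)
  then have "cmod (cis a - cis b) = 2 * \<bar>sin ((a - b) / 2)\<bar>"
    by (simp only: norm_mult norm_cis dist_exp_i_1 mult_1)
  also have "\<dots> \<le> \<bar>a - b\<bar>" using abs_sin_x_le_abs_x[of "(a - b) / 2"] by simp
  finally show ?thesis .
qed

lemma cmod_reciprocal_le_1: "1 \<le> x \<Longrightarrow> cmod (of_real (1 / x)) \<le> 1"
  by (simp add: norm_divide)

lemma has_vector_derivative_cis:
  "((\<lambda>t. cis (t * l)) has_vector_derivative \<i> * of_real l * cis (t * l)) (at t within S)"
proof -
  have "((\<lambda>z. exp (\<i> * (z * of_real l))) has_field_derivative
      exp (\<i> * (of_real t * of_real l)) * (\<i> * of_real l)) (at (of_real t))"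
    by (auto intro!: derivative_eq_intros)
  from has_vector_derivative_real_field[OF this]
  have "((\<lambda>t. cis (t * l)) has_vector_derivative \<i> * of_real l * cis (t * l)) (at t)"
    by (simp add: cis_conv_exp mult_ac)
  then show ?thesis by (rule has_vector_derivative_at_within)
qed

text \<open>An isometry from the square-summable sequences onto \<open>hspace r\<close>
  (\<open>hnorm_to_h\<close>, \<open>hspaceE\<close>). It turns continuity and differentiability in
  the weighted norm into those of the Banach space type.\<close>

definition to_h :: "real \<Rightarrow> lattice ell2 \<Rightarrow> lattice \<Rightarrow> complex" where
  "to_h r x = (\<lambda>k. of_real (1 / bracket k powr r) * coord x k)"

lemma bracket_pos: "0 < bracket k"
  using bracket_ge_1[of k] by linarith

lemma to_h_sq: "(cmod (to_h r x k))\<^sup>2 * bracket k powr (2 * r) = (cmod (coord x k))\<^sup>2"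
proof -
  have "bracket k powr (2 * r) = (bracket k powr r)\<^sup>2"
    using bracket_pos[of k] by (simp add: powr_power mult.commute)
  then show ?thesis
    using bracket_pos[of k] by (simp add: to_h_def norm_mult norm_divide power_mult_distrib power_divide)
qed

lemma to_h_in_hspace: "to_h r x \<in> hspace r"
  unfolding hspace_def by (simp add: to_h_sq summable_coord)

lemma hnorm_to_h: "hnorm r (to_h r x) = norm x"
  by (simp add: hnorm_def to_h_sq norm_ell2_eq)

lemma to_h_linear:
  "to_h r x k + to_h r y k = to_h r (x + y) k"
  "to_h r x k - to_h r y k = to_h r (x - y) k"
  "to_h r x k / of_real c = to_h r ((1 / c) *\<^sub>R x) k"
  by (simp_all add: to_h_def algebra_simps add_divide_distrib diff_divide_distrib)

lemma hspaceE:
  assumes "f \<in> hspace r"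
  obtains x where "f = to_h r x"
proof
  have "(cmod (of_real (bracket k powr r) * f k))\<^sup>2 = (cmod (f k))\<^sup>2 * bracket k powr (2 * r)" for k
  proof -
    have "bracket k powr (2 * r) = (bracket k powr r)\<^sup>2"
      using bracket_pos[of k] by (simp add: powr_power mult.commute)
    then show ?thesis by (simp add: norm_mult power_mult_distrib)
  qed
  then have "coord (Abs_ell2 (\<lambda>k. of_real (bracket k powr r) * f k)) = (\<lambda>k. of_real (bracket k powr r) * f k)"
    using assms by (intro Abs_ell2_inverse) (simp add: hspace_def)
  then show "f = to_h r (Abs_ell2 (\<lambda>k. of_real (bracket k powr r) * f k))"
    using bracket_pos by (auto simp: to_h_def fun_eq_iff less_imp_neq[symmetric])
qed

lemma h_continuous_to_h:
  "h_continuous r (\<lambda>t. to_h r (X t)) \<longleftrightarrow> continuous_on {0..} X"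
  unfolding h_continuous_def continuous_on_def
  by (auto simp: to_h_in_hspace to_h_linear hnorm_to_h tendsto_norm_zero_iff LIM_zero_iff)

lemma h_C1_to_h:
  "h_C1 r (\<lambda>t. to_h r (X t)) (\<lambda>t. to_h r (Y t)) \<longleftrightarrow> continuous_on {0..} X \<and> continuous_on {0..} Y \<and>
     (\<forall>t\<ge>0. (X has_vector_derivative Y t) (at t within {0..}))"
  unfolding h_C1_def h_continuous_to_h has_vector_derivative_iff_quotient
  by (simp add: to_h_linear hnorm_to_h tendsto_norm_zero_iff LIM_zero_iff del: of_real_diff)

lemma h_continuousE:
  assumes "h_continuous r u"
  obtains X where "continuous_on {0..} X" "\<And>t. 0 \<le> t \<Longrightarrow> u t = to_h r (X t)"
proof -
  have "\<exists>x. 0 \<le> t \<longrightarrow> u t = to_h r x" for t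
    using assms hspaceE[of "u t" r] unfolding h_continuous_def by metis
  then obtain X where X: "\<And>t. 0 \<le> t \<Longrightarrow> u t = to_h r (X t)" by metis
  have "((\<lambda>t'. hnorm r (\<lambda>k. to_h r (X t') k - to_h r (X t) k)) \<longlongrightarrow> 0) (at t within {0..})" if "0 \<le> t" for t
  proof -
    have "((\<lambda>t'. hnorm r (\<lambda>k. u t' k - u t k)) \<longlongrightarrow> 0) (at t within {0..})"
      using assms that by (simp add: h_continuous_def)
    then show ?thesis
      by (rule Lim_transform_eventually) (use X that in \<open>auto simp: eventually_at_filter\<close>)
  qed
  then have "h_continuous r (\<lambda>t. to_h r (X t))" by (simp add: h_continuous_def to_h_in_hspace)
  with X show thesis by (intro that[of X]) (simp_all add: h_continuous_to_h)
qed

text \<open>Evaluation at \<open>k\<close> is continuous on \<open>hspace r\<close> for every real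
  \<open>r\<close>, also for the negative orders \<open>s - 2\<close> that occur when
  \<open>s\<close> is small.\<close>

lemma h_C1_coordinate:
  assumes "h_C1 r u u'" "0 \<le> t"
  shows "((\<lambda>t. u t k) has_vector_derivative u' t k) (at t within {0..})"
proof -
  obtain X where X: "\<And>t. 0 \<le> t \<Longrightarrow> u t = to_h r (X t)"
    using assms(1) unfolding h_C1_def by (metis h_continuousE)
  obtain Y where Y: "\<And>t. 0 \<le> t \<Longrightarrow> u' t = to_h r (Y t)"
    using assms(1) unfolding h_C1_def by (metis h_continuousE)
  let ?q = "\<lambda>s. (1 / (s - t)) *\<^sub>R (X s - X t)"
  have "((\<lambda>s. hnorm r (\<lambda>k. (u s k - u t k) / of_real (s - t) - u' t k)) \<longlongrightarrow> 0) (at t within {0..})"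
    using assms by (simp add: h_C1_def)
  then have "((\<lambda>s. norm (?q s - Y t)) \<longlongrightarrow> 0) (at t within {0..})"
    by (rule Lim_transform_eventually)
       (use X Y assms(2) in \<open>auto simp: eventually_at_filter to_h_linear hnorm_to_h simp del: of_real_diff\<close>)
  then have "(?q \<longlongrightarrow> Y t) (at t within {0..})" by (simp add: tendsto_norm_zero_iff LIM_zero_iff)
  then have "((\<lambda>s. of_real (1 / bracket k powr r) * coord (?q s) k) \<longlongrightarrow> of_real (1 / bracket k powr r) * coord (Y t) k) (at t within {0..})"
    by (intro tendsto_intros bounded_linear.tendsto[OF bounded_linear_coord])
  then have "((\<lambda>s. (1 / (s - t)) *\<^sub>R (u s k - u t k)) \<longlongrightarrow> u' t k) (at t within {0..})"
    unfolding Y[OF assms(2)] to_h_def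
    by (rule Lim_transform_eventually)
       (use X assms(2) in \<open>auto simp: eventually_at_filter to_h_def scaleR_conv_of_real algebra_simps diff_divide_distrib\<close>)
  then show ?thesis unfolding has_vector_derivative_iff_quotient .
qed

text \<open>The linear part costs two powers of \<open>bracket\<close>, whence the order
  \<open>s - 2\<close> for the time derivative.\<close>

lemma eigenval_le: "\<bar>eigenval \<omega> k\<bar> / (bracket k)\<^sup>2 \<le> 1 + \<omega>\<^sup>2"
proof -
  have "0 \<le> \<omega>\<^sup>2 * (real_of_int (fst k))\<^sup>2" by simp
  then have "\<bar>eigenval \<omega> k\<bar> \<le> (1 + \<omega>\<^sup>2) * (bracket k)\<^sup>2"
    unfolding bracket_sq sqnorm_def eigenval_def by (simp add: algebra_simps abs_of_nonneg)
  then show ?thesis using bracket_pos[of k] by (simp add: pos_divide_le_eq)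
qed

section \<open>Solutions of the Cauchy problem and the interaction picture\<close>

locale resonant_flow = cubic_flow "resonance_set \<omega> \<Lambda> \<tau>" A "eigenval \<omega>" "of_real \<epsilon> * \<i>"
  for \<omega> \<Lambda> \<tau> A \<epsilon>
begin

lemma fiber_eq: "fiber k = qr_triples \<omega> \<Lambda> \<tau> k"
  unfolding fiber_def qr_triples_def by (simp add: resonance_set_def)

lemma cubic_term_summable: "cubic_term (coord x) summable_on qr_triples \<omega> \<Lambda> \<tau> k"
proof -
  have "coeff_le (\<lambda>_ _ _ _. 1) 1" by (auto simp: coeff_le_def)
  from term3_summable[OF this, of x x x k] show ?thesis
    by (simp add: term3_def cubic_term_def fiber_eq)
qed

lemma coord_cubic:
  "coord (cubic x) k = of_real \<epsilon> * \<i> * (\<Sum>\<^sub>\<infinity>p\<in>qr_triples \<omega> \<Lambda> \<tau> k. cubic_term (coord x) p)"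
proof -
  have "term3 (\<lambda>_ _ _ _. of_real \<epsilon> * \<i>) x x x k = (\<lambda>p. of_real \<epsilon> * \<i> * cubic_term (coord x) p)"
    by (auto simp: term3_def cubic_term_def)
  then show ?thesis
    unfolding cubic_def coord_tri[OF coeff_const] fiber_eq
    by (simp only:) (rule infsum_cmult_right, rule cubic_term_summable)
qed

lemma coord_diag_weight:
  assumes "0 \<le> s"
  shows "coord (diag (\<lambda>k. of_real (1 / bracket k powr s)) x) = to_h s x"
proof
  have "cmod (of_real (1 / bracket k powr s)) \<le> 1" for k
    using bracket_ge_1[of k] assms by (intro cmod_reciprocal_le_1 ge_one_powr_ge_zero)
  from coord_diag[OF this] show "coord (diag (\<lambda>k. of_real (1 / bracket k powr s)) x) k = to_h s x k" for k
    by (simp add: to_h_def)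
qed

text \<open>The time derivative exists in \<open>hspace (s - 2)\<close> only, possibly a larger
  space than the unweighted one, so the integral equation is verified coordinate by coordinate: both
  sides have the same scalar derivative and initial value.\<close>

lemma solution_interaction_form:
  assumes sol: "is_solution \<omega> \<Lambda> \<tau> s \<epsilon> v0 w" and s: "0 \<le> s" and V: "v0 = coord V"
  obtains y where "continuous_on {0..} y" "\<And>t. 0 \<le> t \<Longrightarrow> y t = V + integral {0..t} (\<lambda>s. field s (y s))"
    "\<And>t. 0 \<le> t \<Longrightarrow> w t = coord (U t (y t))"
proof -
  obtain w' where w': "h_C1 (s - 2) w w'"
    and eq: "\<And>t k. 0 \<le> t \<Longrightarrow> w' t k = \<i> * of_real (eigenval \<omega> k) * w t k
      + of_real \<epsilon> * \<i> * (\<Sum>\<^sub>\<infinity>p\<in>qr_triples \<omega> \<Lambda> \<tau> k. cubic_term (w t) p)"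
    and cont: "h_continuous s w" and w0: "w 0 = v0"
    using sol unfolding is_solution_def by blast
  obtain X where X: "continuous_on {0..} X" "\<And>t. 0 \<le> t \<Longrightarrow> w t = to_h s (X t)"
    using h_continuousE[OF cont] by blast
  \<comment> \<open>The same sequence as \<open>w t\<close>, regarded as an unweighted vector; as
    \<open>s\<close> is nonnegative, this embedding is bounded.\<close>
  define x where "x = (\<lambda>t. diag (\<lambda>k. of_real (1 / bracket k powr s)) (X t))"
  define y where "y = (\<lambda>t. U (- t) (x t))"
  have wx: "w t = coord (x t)" if "0 \<le> t" for t
    unfolding x_def coord_diag_weight[OF s] by (rule X(2)[OF that])
  have "cmod (of_real (1 / bracket k powr s)) \<le> 1" for k
    using bracket_ge_1[of k] s by (intro cmod_reciprocal_le_1 ge_one_powr_ge_zero)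
  then have x_cont: "continuous_on {0..} x"
    unfolding x_def by (intro bounded_linear.continuous_on[OF bounded_linear_diag X(1)])
  then have y_cont: "continuous_on {0..} y"
    unfolding y_def by (intro continuous_on_phase continuous_intros)
  have wy: "w t = coord (U t (y t))" if "0 \<le> t" for t
    using wx[OF that] by (simp add: y_def)
  define Y where "Y = (\<lambda>t. V + integral {0..t} (\<lambda>s. field s (y s)))"
  have "y t = Y t" if "0 \<le> t" for t
  proof (rule ell2_eqI)
    fix k
    have yk: "((\<lambda>t. coord (y t) k) has_vector_derivative coord (field t (y t)) k) (at t within {0..})"
      if t: "t \<in> {0..}" for t
    proof (rule has_vector_derivative_transform[OF t])
      show "coord (y t) k = cis (t * - eigenval \<omega> k) * w t k" if "t \<in> {0..}" for t
        using that by (simp add: y_def wx)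
      \<comment> \<open>The derivative of the phase cancels the linear term of the equation and only
        the cubic term survives.\<close>
      have d: "((\<lambda>t. cis (t * - eigenval \<omega> k) * w t k) has_vector_derivative
          cis (t * - eigenval \<omega> k) * w' t k + \<i> * of_real (- eigenval \<omega> k) * cis (t * - eigenval \<omega> k) * w t k)
          (at t within {0..})"
        using t by (intro has_vector_derivative_mult has_vector_derivative_cis h_C1_coordinate[OF w']) auto
      have f: "coord (field t (y t)) k = cis (t * - eigenval \<omega> k) *
          (of_real \<epsilon> * \<i> * (\<Sum>\<^sub>\<infinity>p\<in>qr_triples \<omega> \<Lambda> \<tau> k. cubic_term (coord (x t)) p))"
        unfolding field_def y_def coord_cubic[symmetric] by simp
      have "coord (field t (y t)) k =
          cis (t * - eigenval \<omega> k) * w' t k + \<i> * of_real (- eigenval \<omega> k) * cis (t * - eigenval \<omega> k) * w t k"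
        unfolding f using t eq[of t k] by (simp add: wx algebra_simps)
      with d show "((\<lambda>t. cis (t * - eigenval \<omega> k) * w t k) has_vector_derivative coord (field t (y t)) k)
          (at t within {0..})" by simp
    qed
    have Yk: "((\<lambda>t. coord (Y t) k) has_vector_derivative coord (field t (y t)) k) (at t within {0..})"
      if "t \<in> {0..}" for t
      unfolding Y_def
      using that integral_has_vector_derivative_atLeast[OF continuous_on_field[OF y_cont], of t]
      by (intro bounded_linear.has_vector_derivative[OF bounded_linear_coord])
         (auto intro!: derivative_eq_intros)
    have "((\<lambda>t. coord (y t) k - coord (Y t) k) has_vector_derivative 0) (at t within {0..})"
      if "t \<in> {0..}" for t
      using has_vector_derivative_diff[OF yk[OF that] Yk[OF that]] by simp
    then obtain c where c: "\<And>t. t \<in> {0..} \<Longrightarrow> coord (y t) k - coord (Y t) k = c"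
      using has_vector_derivative_zero_constant[of "{0..}" "\<lambda>t. coord (y t) k - coord (Y t) k"] by auto
    have "coord (y 0) k = coord (Y 0) k"
      using wx[of 0] w0 V by (simp add: y_def Y_def)
    then show "coord (y t) k = coord (Y t) k" using c[of 0] c[of t] \<open>0 \<le> t\<close> by simp
  qed
  then show thesis
    using wy by (intro that[OF y_cont]) (simp_all add: Y_def)
qed

lemma solution_unique:
  assumes "is_solution \<omega> \<Lambda> \<tau> s \<epsilon> v0 w" "is_solution \<omega> \<Lambda> \<tau> s \<epsilon> v0 z" "0 \<le> s" "v0 = coord V" "0 \<le> t"
  shows "w t = z t"
proof -
  obtain y where y: "continuous_on {0..} y" "\<And>t. 0 \<le> t \<Longrightarrow> y t = V + integral {0..t} (\<lambda>s. field s (y s))"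
    "\<And>t. 0 \<le> t \<Longrightarrow> w t = coord (U t (y t))"
    using solution_interaction_form[OF assms(1,3,4)] by blast
  obtain x where x: "continuous_on {0..} x" "\<And>t. 0 \<le> t \<Longrightarrow> x t = V + integral {0..t} (\<lambda>s. field s (x s))"
    "\<And>t. 0 \<le> t \<Longrightarrow> z t = coord (U t (x t))"
    using solution_interaction_form[OF assms(2,3,4)] by blast
  show ?thesis
    using ell2_unique[OF y(1,2) x(1,2) assms(5)] y(3) x(3) assms(5) by simp
qed

text \<open>\<open>E\<close> gives up two powers of the weight, which makes \<open>D\<close>, the
  composition of \<open>E\<close> with the generator, bounded. After applying \<open>E\<close>, the
  phase can be differentiated in norm by dominated convergence.\<close>

lemma phase_has_vector_derivative:
  assumes u: "(u has_vector_derivative g) (at t within T)"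
  defines "E \<equiv> diag (\<lambda>k. of_real (1 / (bracket k)\<^sup>2))"
    and "D \<equiv> diag (\<lambda>k. \<i> * of_real (eigenval \<omega> k / (bracket k)\<^sup>2))"
  shows "((\<lambda>t. E (U t (u t))) has_vector_derivative D (U t (u t)) + E (U t g)) (at t within T)"
proof -
  have E1: "cmod (of_real (1 / (bracket k)\<^sup>2)) \<le> 1" for k
    using bracket_ge_1[of k] by (intro cmod_reciprocal_le_1 one_le_power)
  have D1: "cmod (\<i> * of_real (eigenval \<omega> k / (bracket k)\<^sup>2)) \<le> 1 + \<omega>\<^sup>2" for k
    using eigenval_le[of \<omega> k] by (simp add: norm_mult norm_divide norm_power)
  have cE: "coord (E x) k = of_real (1 / (bracket k)\<^sup>2) * coord x k" for x k
    unfolding E_def by (rule coord_diag[OF E1])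
  have cD: "coord (D x) k = \<i> * of_real (eigenval \<omega> k / (bracket k)\<^sup>2) * coord x k" for x k
    unfolding D_def by (rule coord_diag[OF D1])
  define q where "q = (\<lambda>s. (1 / (s - t)) *\<^sub>R (u s - u t))"
  \<comment> \<open>Symbol of the difference between quotient and derivative of the phase, damped by
    \<open>E\<close>: uniformly bounded, and convergent to 0 for each \<open>k\<close>.\<close>
  define n where "n = (\<lambda>s k. of_real (1 / (bracket k)\<^sup>2) *
      ((1 / (s - t)) *\<^sub>R (cis (s * eigenval \<omega> k) - cis (t * eigenval \<omega> k))
        - \<i> * of_real (eigenval \<omega> k) * cis (t * eigenval \<omega> k)))"
  have n: "cmod (n s k) \<le> 2 * (1 + \<omega>\<^sup>2)" for s k
  proof -
    \<comment> \<open>\<open>tendsto_diag\<close> asks for the bound at every time. At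
      \<open>s = t\<close> the quotient is 0, the default value of division by zero.\<close>
    have a: "cmod ((1 / (s - t)) *\<^sub>R (cis (s * eigenval \<omega> k) - cis (t * eigenval \<omega> k))) \<le> \<bar>eigenval \<omega> k\<bar>"
    proof (cases "s = t")
      case False
      have "cmod (cis (s * eigenval \<omega> k) - cis (t * eigenval \<omega> k)) \<le> \<bar>s - t\<bar> * \<bar>eigenval \<omega> k\<bar>"
        using cmod_cis_diff_le[of "s * eigenval \<omega> k" "t * eigenval \<omega> k"]
        by (simp add: abs_mult flip: left_diff_distrib)
      then show ?thesis using False by (simp add: pos_divide_le_eq mult.commute)
    qed simp
    have b: "cmod (\<i> * of_real (eigenval \<omega> k) * cis (t * eigenval \<omega> k)) \<le> \<bar>eigenval \<omega> k\<bar>"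
      by (simp add: norm_mult)
    have "cmod (n s k) \<le> 1 / (bracket k)\<^sup>2 * (\<bar>eigenval \<omega> k\<bar> + \<bar>eigenval \<omega> k\<bar>)"
      unfolding n_def norm_mult norm_of_real
      by (intro mult_mono order_trans[OF norm_triangle_ineq4 add_mono[OF a b]]) auto
    then show ?thesis using eigenval_le[of \<omega> k] by simp
  qed
  have "((\<lambda>s. n s k) \<longlongrightarrow> of_real (1 / (bracket k)\<^sup>2) * (\<i> * of_real (eigenval \<omega> k) * cis (t * eigenval \<omega> k)
      - \<i> * of_real (eigenval \<omega> k) * cis (t * eigenval \<omega> k))) (at t within T)" for k
    unfolding n_def
    by (intro tendsto_intros has_vector_derivative_cis[THEN has_vector_derivative_iff_quotient[THEN iffD1]])
  then have "((\<lambda>s. diag (n s) (u t)) \<longlongrightarrow> 0) (at t within T)"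
    by (intro tendsto_diag[OF n]) simp
  moreover have "((\<lambda>s. E (U s (q s))) \<longlongrightarrow> E (U t g)) (at t within T)"
    unfolding E_def q_def
    by (intro bounded_linear.tendsto[OF bounded_linear_diag[OF E1]] tendsto_phase tendsto_ident_at
        has_vector_derivative_iff_quotient[THEN iffD1, OF u])
  ultimately have "((\<lambda>s. diag (n s) (u t) + D (U t (u t)) + E (U s (q s))) \<longlongrightarrow> 0 + D (U t (u t)) + E (U t g)) (at t within T)"
    by (intro tendsto_intros)
  \<comment> \<open>The difference quotient splits into the remainder of the phase, its derivative,
    and the quotient of \<open>u\<close> transported by the phase.\<close>
  moreover have "diag (n s) (u t) + D (U t (u t)) + E (U s (q s)) = (1 / (s - t)) *\<^sub>R (E (U s (u s)) - E (U t (u t)))" for s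
    by (rule ell2_eqI)
       (simp add: coord_diag[OF n] cE cD, simp add: n_def q_def scaleR_conv_of_real algebra_simps add_divide_distrib diff_divide_distrib)
  ultimately show ?thesis
    unfolding has_vector_derivative_iff_quotient by simp
qed

text \<open>The weighted solution \<open>u\<close> of the interaction picture is carried back by the
  phase. It is read through \<open>to_h s\<close> for continuity and through
  \<open>to_h (s - 2)\<close> after \<open>E\<close> for the time derivative.\<close>

lemma solution_exists:
  assumes s: "0 \<le> s" and v0: "v0 \<in> hspace s" and C: "1 \<le> C"
    and dom: "\<And>k1 k2 k3 k4. (k1, k2, k3, k4) \<in> resonance_set \<omega> \<Lambda> \<tau> \<Longrightarrow>
      bracket k4 \<le> C * bracket (if sqnorm k2 \<le> sqnorm k1 then k1 else k2)"
  obtains z where "is_solution \<omega> \<Lambda> \<tau> s \<epsilon> v0 z"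
proof -
  obtain v where v: "v0 = to_h s v" using hspaceE[OF v0] .
  define J where "J = diag (\<lambda>k. of_real (1 / bracket k powr s))"
  have w1: "1 \<le> bracket k powr s" for k
    using bracket_ge_1[of k] s by (simp add: ge_one_powr_ge_zero)
  have Cs: "0 \<le> C powr s" by simp
  have wdom: "bracket k4 powr s \<le> C powr s * bracket (if sqnorm k2 \<le> sqnorm k1 then k1 else k2) powr s"
    if "(k1, k2, k3, k4) \<in> resonance_set \<omega> \<Lambda> \<tau>" for k1 k2 k3 k4
    using powr_mono2[OF s _ dom[OF that]] bracket_pos[of k4] C
      bracket_pos[of "if sqnorm k2 \<le> sqnorm k1 then k1 else k2"]
    by (simp add: powr_mult less_imp_le)
  obtain u g where u: "continuous_on {0..} u" "continuous_on {0..} g" "u 0 = v"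
    "\<And>t. 0 \<le> t \<Longrightarrow> (u has_vector_derivative g t) (at t within {0..})"
    "\<And>t. 0 \<le> t \<Longrightarrow> J (g t) = field t (J (u t))"
    unfolding J_def
    by (rule weighted_exists[where h="\<lambda>k1 k2. sqnorm k2 \<le> sqnorm k1" and w="\<lambda>k. bracket k powr s" and v=v,
          OF w1 Cs], erule wdom, blast)
  have cJ: "coord (J x) = to_h s x" for x unfolding J_def by (rule coord_diag_weight[OF s])
  have J_U: "J (U t x) = U t (J x)" for t x
    by (rule ell2_eqI) (simp add: cJ to_h_def)
  define E where "E = diag (\<lambda>k. of_real (1 / (bracket k)\<^sup>2))"
  define D where "D = diag (\<lambda>k. \<i> * of_real (eigenval \<omega> k / (bracket k)\<^sup>2))"
  have E1: "cmod (of_real (1 / (bracket k)\<^sup>2)) \<le> 1" for k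
    using bracket_ge_1[of k] by (intro cmod_reciprocal_le_1 one_le_power)
  have D1: "cmod (\<i> * of_real (eigenval \<omega> k / (bracket k)\<^sup>2)) \<le> 1 + \<omega>\<^sup>2" for k
    using eigenval_le[of \<omega> k] by (simp add: norm_mult norm_divide norm_power)
  have powr_s: "bracket k powr (s - 2) * (bracket k)\<^sup>2 = bracket k powr s" for k
    using bracket_pos[of k] by (simp add: powr_diff powr_numeral)
  have pw: "complex_of_real (1 / bracket k powr (s - 2)) * of_real (1 / (bracket k)\<^sup>2) = of_real (1 / bracket k powr s)" for k
    by (simp only: of_real_mult[symmetric] times_divide_times_eq mult_1 powr_s)
  have split: "complex_of_real (eigenval \<omega> k / (bracket k)\<^sup>2) = of_real (eigenval \<omega> k) * of_real (1 / (bracket k)\<^sup>2)" for k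
    by simp
  \<comment> \<open>\<open>E\<close> realizes the inclusion of order \<open>s\<close> into order
    \<open>s - 2\<close>, and \<open>D\<close> realizes the linear part of the equation between
    these orders.\<close>
  have cE: "to_h (s - 2) (E x) k = to_h s x k" for x k
    unfolding E_def to_h_def coord_diag[OF E1] by (simp only: mult.assoc[symmetric] pw)
  have cD: "to_h (s - 2) (D x) k = \<i> * of_real (eigenval \<omega> k) * to_h s x k" for x k
    unfolding D_def to_h_def coord_diag[OF D1] unfolding split pw[symmetric] by (simp only: mult_ac)
  define z where "z = (\<lambda>t. to_h s (U t (u t)))"
  define z' where "z' = (\<lambda>t. to_h (s - 2) (D (U t (u t)) + E (U t (g t))))"
  have z_E: "z = (\<lambda>t. to_h (s - 2) (E (U t (u t))))"
    by (auto simp: z_def fun_eq_iff cE)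
  have Uu: "continuous_on {0..} (\<lambda>t. U t (u t))" and Ug: "continuous_on {0..} (\<lambda>t. U t (g t))"
    by (intro continuous_on_phase continuous_intros u)+
  have "h_C1 (s - 2) z z'"
    unfolding z_E z'_def h_C1_to_h
  proof (intro conjI allI impI)
    show "continuous_on {0..} (\<lambda>t. E (U t (u t)))"
      "continuous_on {0..} (\<lambda>t. D (U t (u t)) + E (U t (g t)))"
      unfolding E_def D_def
      by (intro continuous_intros bounded_linear.continuous_on[OF bounded_linear_diag[OF E1]]
          bounded_linear.continuous_on[OF bounded_linear_diag[OF D1]] Uu Ug)+
    show "((\<lambda>t. E (U t (u t))) has_vector_derivative D (U t (u t)) + E (U t (g t))) (at t within {0..})"
      if "0 \<le> t" for t
      unfolding E_def D_def by (rule phase_has_vector_derivative[OF u(4)[OF that]])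
  qed
  moreover have zJ: "z t = coord (U t (J (u t)))" for t
    by (simp add: z_def flip: cJ J_U)
  moreover have "z' t k = \<i> * of_real (eigenval \<omega> k) * z t k
      + of_real \<epsilon> * \<i> * (\<Sum>\<^sub>\<infinity>p\<in>qr_triples \<omega> \<Lambda> \<tau> k. cubic_term (z t) p)" if "0 \<le> t" for t k
  proof -
    have "U t (J (g t)) = cubic (U t (J (u t)))"
      by (simp add: u(5)[OF that] field_def)
    then have "to_h s (U t (g t)) k = of_real \<epsilon> * \<i> * (\<Sum>\<^sub>\<infinity>p\<in>qr_triples \<omega> \<Lambda> \<tau> k. cubic_term (z t) p)"
      unfolding zJ coord_cubic[symmetric] by (simp flip: cJ J_U)
    then show ?thesis
      by (simp add: z'_def to_h_linear[symmetric] cD cE) (simp add: z_def)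
  qed
  moreover have "h_continuous s z" unfolding z_def by (simp add: h_continuous_to_h Uu)
  moreover have "z 0 = v0" by (simp add: z_def u(3) v)
  ultimately have "is_solution \<omega> \<Lambda> \<tau> s \<epsilon> v0 z"
    unfolding is_solution_def using cubic_term_summable by (intro conjI exI[of _ z']) auto
  then show thesis by (rule that)
qed

end

theorem theorem9:
  fixes \<omega> \<Lambda> \<tau> s \<epsilon> :: real and v0 :: "int \<times> int \<Rightarrow> complex"
  assumes "\<omega> > 0" and "generic_irrational (\<omega>\<^sup>2)"
    and "\<Lambda> > 0" and "\<tau> > 1" and "s \<ge> 0"
    and "v0 \<in> hspace s"
    and "\<epsilon> \<in> {1, -1}"
  shows "\<exists>z. is_solution \<omega> \<Lambda> \<tau> s \<epsilon> v0 z \<and>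
           (\<forall>w. is_solution \<omega> \<Lambda> \<tau> s \<epsilon> v0 w \<longrightarrow> (\<forall>t\<ge>0. w t = z t))"
proof -
  have fin: "finite (resonance_set \<omega> \<Lambda> \<tau> - axis_rectangles)"
    using assms by (intro finite_non_rectangles) auto
  obtain C where C: "1 \<le> C" "\<And>k1 k2 k3 k4. (k1, k2, k3, k4) \<in> resonance_set \<omega> \<Lambda> \<tau> \<Longrightarrow>
      bracket k4 \<le> C * bracket (if sqnorm k2 \<le> sqnorm k1 then k1 else k2)"
    using bracket_dominated[OF fin] by blast
  define A where "A = real (4 + card (resonance_set \<omega> \<Lambda> \<tau> - axis_rectangles))"
  interpret quartet_form "resonance_set \<omega> \<Lambda> \<tau>" A
    using quartet_form_resonance_set[OF fin] by (simp add: A_def)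
  interpret resonant_flow \<omega> \<Lambda> \<tau> A \<epsilon>
  proof
    \<comment> \<open>Exchanging the pairs changes only the signs of the momentum sum and of the
      frequency defect and preserves the total size.\<close>
    show "(k3, k4, k1, k2) \<in> resonance_set \<omega> \<Lambda> \<tau>" if "(k1, k2, k3, k4) \<in> resonance_set \<omega> \<Lambda> \<tau>" for k1 k2 k3 k4
    proof -
      have "k3 + k4 - k1 - k2 = - (k1 + k2 - k3 - k4)" by simp
      then show ?thesis
        using that by (auto simp: resonance_set_def quasi_resonant_def add_ac abs_minus_commute algebra_simps)
    qed
  qed simp
  obtain z where z: "is_solution \<omega> \<Lambda> \<tau> s \<epsilon> v0 z"
    by (rule solution_exists[OF assms(5,6) C(1)], erule C(2), blast)
  \<comment> \<open>The initial value also lies in the unweighted space, where uniqueness is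
    decided.\<close>
  obtain v where "v0 = to_h s v" using hspaceE[OF assms(6)] .
  then have "v0 = coord (diag (\<lambda>k. of_real (1 / bracket k powr s)) v)"
    using coord_diag_weight[OF assms(5)] by simp
  then show ?thesis using z solution_unique[OF _ z assms(5)] by blast
qed

end
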